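(* Let $C$ be a 2-copula, let $\theta\in[0,1]$, and let $\hat C_\theta=C+\theta(M-C)$ and $\tilde C_\theta=C+\theta(\Pi-C)$. Let $(X_0,X_1,\dots,X_n)$, $n\ge 1$, be a stationary Markov chain with uniform marginals on $(0,1)$. If the chain is generated by $\hat C_\theta$, then the joint distribution function (copula) of $(X_0,X_n)$ is $$\hat C_\theta^{\,n}(u,v)=\sum_{i=1}^{n}\binom{n}{i}\theta^{n-i}(1-\theta)^{i}C^{i}(u,v)+\theta^nM(u,v),$$ and if the chain is generated by $\tilde C_\theta$, then the joint distribution function (copula) of $(X_0,X_n)$ is $$\tilde C_\theta^{\,n}(u,v)=(1-\theta)^nC^{n}(u,v)+\bigl(1-(1-\theta)^n\bigr)\Pi(u,v).$$
   Context: A 2-copula is a function $C:[0,1]^2\to[0,1]$ with $C(0,x)=C(x,0)=0$, $C(1,x)=C(x,1)=x$ for all $x\in[0,1]$ and $C(x_1,y_1)+C(x_2,y_2)-C(x_1,y_2)-C(x_2,y_1)\ge 0$ for all $[x_1,x_2]\times[y_1,y_2]\subset[0,1]^2$. $M(u,v)=\min(u,v)$ and $\Pi(u,v)=uv$. The fold product of copulas $A,B$ is $A*B(x,y)=\int_0^1 A_{,2}(x,t)B_{,1}(t,y)\,dt$, where $A_{,i}$ is the partial derivative with respect to the $i$-th variable (existing almost everywhere). Powers are defined by $C^1=C$ and $C^n=C^{n-1}*C$. A stationary Markov chain with uniform marginals is generated by a copula $D$ if each consecutive pair $(X_i,X_{i+1})$ has joint distribution function $D$ (equivalently, the transition probability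 from $x$ to $[0,y]$ is $D_{,1}(x,y)$ for a.e. $x$). *)

theory Defs
  imports "HOL-Probability.Probability"
begin

text \<open>
  Copulas are represented by total functions on the plane. Only the values on the closed unit square
  are constrained or used.
\<close>

definition is_copula :: "(real \<Rightarrow> real \<Rightarrow> real) \<Rightarrow> bool" where
  "is_copula C \<longleftrightarrow>
     (\<forall>x\<in>{0..1}. \<forall>y\<in>{0..1}. C x y \<in> {0..1}) \<and>
     (\<forall>x\<in>{0..1}. C 0 x = 0 \<and> C x 0 = 0 \<and> C 1 x = x \<and> C x 1 = x) \<and>
     (\<forall>x1 x2 y1 y2. 0 \<le> x1 \<longrightarrow> x1 \<le> x2 \<longrightarrow> x2 \<le> 1 \<longrightarrow> 0 \<le> y1 \<longrightarrow> y1 \<le> y2 \<longrightarrow> y2 \<le> 1 \<longrightarrow>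
        C x1 y1 + C x2 y2 - C x1 y2 - C x2 y1 \<ge> 0)"

definition min_copula :: "real \<Rightarrow> real \<Rightarrow> real" where
  "min_copula u v = min u v"

definition indep_copula :: "real \<Rightarrow> real \<Rightarrow> real" where
  "indep_copula u v = u * v"

definition hat_copula :: "real \<Rightarrow> (real \<Rightarrow> real \<Rightarrow> real) \<Rightarrow> real \<Rightarrow> real \<Rightarrow> real" where
  "hat_copula \<theta> C u v = C u v + \<theta> * (min_copula u v - C u v)"

definition tilde_copula :: "real \<Rightarrow> (real \<Rightarrow> real \<Rightarrow> real) \<Rightarrow> real \<Rightarrow> real \<Rightarrow> real" where
  "tilde_copula \<theta> C u v = C u v + \<theta> * (indep_copula u v - C u v)"

text \<open>
  The interval integral ranges over the open interval, so the derivatives involve only values on the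
  unit square. Where a partial derivative does not exist, \<^const>\<open>deriv\<close> is an unspecified
  constant; for copulas this happens only on a null set.
\<close>

definition fold_product ::
    "(real \<Rightarrow> real \<Rightarrow> real) \<Rightarrow> (real \<Rightarrow> real \<Rightarrow> real) \<Rightarrow> real \<Rightarrow> real \<Rightarrow> real" where
  "fold_product A B x y = (LBINT t=0..1. deriv (\<lambda>s. A x s) t * deriv (\<lambda>s. B s y) t)"

text \<open>The zeroth power is only a totalising convention (the unit of the fold product).\<close>

fun copula_power :: "(real \<Rightarrow> real \<Rightarrow> real) \<Rightarrow> nat \<Rightarrow> real \<Rightarrow> real \<Rightarrow> real" where
  "copula_power C 0 = min_copula"
| "copula_power C (Suc 0) = C"
| "copula_power C (Suc (Suc n)) = fold_product (copula_power C (Suc n)) C"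

definition joint_cdf :: "'a measure \<Rightarrow> ('a \<Rightarrow> real) \<Rightarrow> ('a \<Rightarrow> real) \<Rightarrow> real \<Rightarrow> real \<Rightarrow> real" where
  "joint_cdf M X Y u v = measure M {\<omega> \<in> space M. X \<omega> \<le> u \<and> Y \<omega> \<le> v}"

text \<open>
  Finite-horizon chains \<open>X 0, \<dots>, X n\<close>; the functions \<open>X i\<close> with \<open>i > n\<close> play no role.
  The Markov property compares conditioning on the sigma-algebra generated by the vector
  \<open>(X 0, \<dots>, X i)\<close> with conditioning on the one generated by \<open>X i\<close>.
\<close>

definition markov_chain :: "'a measure \<Rightarrow> (nat \<Rightarrow> 'a \<Rightarrow> real) \<Rightarrow> nat \<Rightarrow> bool" where
  "markov_chain M X n \<longleftrightarrow>
     (\<forall>i\<le>n. X i \<in> borel_measurable M) \<and>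
     (\<forall>i<n. \<forall>B\<in>sets borel. AE \<omega> in M.
        real_cond_exp M
          (vimage_algebra (space M) (\<lambda>\<omega>. \<lambda>j\<in>{..i}. X j \<omega>) (\<Pi>\<^sub>M j\<in>{..i}. borel))
          (\<lambda>\<omega>. indicator B (X (Suc i) \<omega>)) \<omega> =
        real_cond_exp M (vimage_algebra (space M) (X i) borel)
          (\<lambda>\<omega>. indicator B (X (Suc i) \<omega>)) \<omega>)"

definition stationary :: "'a measure \<Rightarrow> (nat \<Rightarrow> 'a \<Rightarrow> real) \<Rightarrow> nat \<Rightarrow> bool" where
  "stationary M X n \<longleftrightarrow>
     (\<forall>h k. h + k \<le> n \<longrightarrow>
        distr M (\<Pi>\<^sub>M j\<in>{..k}. borel) (\<lambda>\<omega>. \<lambda>j\<in>{..k}. X (h + j) \<omega>) =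
        distr M (\<Pi>\<^sub>M j\<in>{..k}. borel) (\<lambda>\<omega>. \<lambda>j\<in>{..k}. X j \<omega>))"

definition uniform_marginals :: "'a measure \<Rightarrow> (nat \<Rightarrow> 'a \<Rightarrow> real) \<Rightarrow> nat \<Rightarrow> bool" where
  "uniform_marginals M X n \<longleftrightarrow>
     (\<forall>i\<le>n. distr M borel (X i) = uniform_measure lborel {0<..<1})"

definition generated_by ::
    "'a measure \<Rightarrow> (nat \<Rightarrow> 'a \<Rightarrow> real) \<Rightarrow> nat \<Rightarrow> (real \<Rightarrow> real \<Rightarrow> real) \<Rightarrow> bool" where
  "generated_by M X n D \<longleftrightarrow>
     (\<forall>i<n. \<forall>u\<in>{0..1}. \<forall>v\<in>{0..1}. joint_cdf M (X i) (X (Suc i)) u v = D u v)"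

end

(*
  A function that is increasing and nonexpansive on [0,1] is differentiable almost everywhere and is
  the integral of its derivative: perturbed by the identity it is a bijection under which null sets
  have null images, so it has a Radon-Nikodym density, and this density is the derivative a.e. by a
  Vitali covering argument. All sections of copulas and of their powers are of this kind.

  Hence the fold product is bilinear on them, M is its unit and Pi its null element, and the two
  closed forms follow by induction; associativity of the fold product is never needed.

  Probabilistically, D_{,1}(X_i, v) is a version of P(X_{i+1} <= v | X_i), and the measure
  S |-> P(X_0 <= u, X_i in S) has density (D^i)_{,2}(u, .). By the Markov property
  P(X_0 <= u, X_{i+1} <= v) is the integral of the product of the two, which is (D^i * D)(u, v).
*)
theory Submission
  imports Defs
begin

section \<open>Lebesgue differentiation on the line\<close>

text \<open>The fold product at \<open>(x, y)\<close> sees one section of each factor, so the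
  algebra is done for a symmetric pairing of functions of one variable. For fixed \<open>u\<close>
  the recursion pairs the section of the n-th power at \<open>u\<close> with a section of the
  generator, and the induction carries just what the next step consumes: that this section is
  increasing and nonexpansive with values 0 and \<open>u\<close> at the ends. The obstacle is
  analytic. The definition uses pointwise derivatives, with an unspecified value where none exists,
  while the probabilistic side produces measures. The two meet only if integrating the derivative
  recovers the increment, and nonexpansiveness excludes a singular part. Then the section is the
  distribution function of the measure whose density is its derivative, and the comparison with the
  law of the chain becomes one of distribution functions.\<close>

lemma set_integral_nonneg_imp_emeasure_density_le:
  fixes k :: "real \<Rightarrow> real"
  assumes k: "integrable lborel k" and A: "A \<in> sets borel"
    and nn: "0 \<le> (\<integral>x\<in>A. k x \<partial>lborel)"
  shows "emeasure (density lborel (\<lambda>x. ennreal (- k x))) A \<le> emeasure (density lborel (\<lambda>x. ennreal (k x))) A"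
proof -
  have [measurable]: "k \<in> borel_measurable borel" "A \<in> sets borel"
    using k A by auto
  \<comment> \<open>\<open>ennreal\<close> sends negative reals to 0, so the two densities are the
    positive and the negative part of \<open>k\<close>.\<close>
  let ?p = "\<lambda>x. max 0 (k x) * indicator A x" and ?m = "\<lambda>x. max 0 (- k x) * indicator A x"
  have ip: "integrable lborel ?p"
    by (rule Bochner_Integration.integrable_bound[OF k]) (auto split: split_indicator)
  have im: "integrable lborel ?m"
    by (rule Bochner_Integration.integrable_bound[OF k]) (auto split: split_indicator)
  have "(\<integral>x\<in>A. k x \<partial>lborel) = (\<integral>x. ?p x - ?m x \<partial>lborel)"
    unfolding set_lebesgue_integral_def
    by (rule Bochner_Integration.integral_cong) (auto split: split_indicator)
  also have "\<dots> = integral\<^sup>L lborel ?p - integral\<^sup>L lborel ?m"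
    by (rule Bochner_Integration.integral_diff[OF ip im])
  finally have le: "integral\<^sup>L lborel ?m \<le> integral\<^sup>L lborel ?p" using nn by simp
  have "emeasure (density lborel (\<lambda>x. ennreal (- k x))) A = (\<integral>\<^sup>+x. ennreal (?m x) \<partial>lborel)"
    by (subst emeasure_density)
       (auto intro!: nn_integral_cong split: split_indicator simp: ennreal_neg max_def)
  also have "\<dots> = ennreal (integral\<^sup>L lborel ?m)"
    by (rule nn_integral_eq_integral[OF im]) auto
  also have "\<dots> \<le> ennreal (integral\<^sup>L lborel ?p)" using le by (rule ennreal_leI)
  also have "\<dots> = (\<integral>\<^sup>+x. ennreal (?p x) \<partial>lborel)"
    by (rule nn_integral_eq_integral[OF ip, symmetric]) auto
  also have "\<dots> = emeasure (density lborel (\<lambda>x. ennreal (k x))) A"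
    by (subst emeasure_density)
       (auto intro!: nn_integral_cong split: split_indicator simp: ennreal_neg max_def)
  finally show ?thesis .
qed

text \<open>
  A Vitali cover of the set by intervals inside an open \<open>U \<supseteq> {k < 0}\<close> bounds the negative part of
  \<open>k\<close> on the set by its positive part on \<open>U\<close>, which is small by outer regularity.
\<close>

lemma negligible_negative_with_nonneg_averages:
  fixes k :: "real \<Rightarrow> real"
  assumes k: "integrable lborel k"
  shows "negligible {x. k x < 0 \<and>
    (\<forall>d>0. \<exists>a b. a \<le> x \<and> x \<le> b \<and> a < b \<and> b - a < d \<and> 0 \<le> (\<integral>t\<in>{a..b}. k t \<partial>lborel))}"
    (is "negligible ?E")
proof -
  have [measurable]: "k \<in> borel_measurable borel" using k by auto
  define P where "P = density lborel (\<lambda>x. ennreal (k x))"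
  define N where "N = density lborel (\<lambda>x. ennreal (- k x))"
  define T where "T = {x. k x < 0}"
  have [measurable]: "T \<in> sets borel" unfolding T_def by simp
  have sP: "sets P = sets borel" and sN: "sets N = sets borel" unfolding P_def N_def by auto
  have "emeasure P T = (\<integral>\<^sup>+x. ennreal (k x) * indicator T x \<partial>lborel)"
    unfolding P_def by (rule emeasure_density) auto
  also have "\<dots> = (\<integral>\<^sup>+(x::real). 0 \<partial>lborel)"
    by (rule nn_integral_cong) (auto simp: T_def ennreal_neg split: split_indicator)
  finally have PT: "emeasure P T = 0" by simp
  have "(\<integral>\<^sup>+x. ennreal (k x) \<partial>lborel) \<le> (\<integral>\<^sup>+x. ennreal (norm (k x)) \<partial>lborel)"
    by (rule nn_integral_mono) (auto intro: ennreal_leI)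
  also have "\<dots> < \<infinity>" using k unfolding integrable_iff_bounded by auto
  finally have fP: "emeasure P (space P) \<noteq> \<infinity>"
    unfolding P_def by (subst emeasure_density) auto
  have cover: "\<exists>V. V \<in> sets borel \<and> emeasure N V \<le> ennreal e \<and> negligible (?E - V)"
    if e: "e > 0" for e :: real
  proof -
    have "(INF U\<in>{U. T \<subseteq> U \<and> open U}. emeasure P U) < ennreal e"
      using outer_regular[OF sP fP, of T] PT e by simp
    then obtain U where U: "T \<subseteq> U" "open U" "emeasure P U < ennreal e"
      by (auto simp: INF_less_iff)
    define K where "K = {(a, b). a < b \<and> {a..b} \<subseteq> U \<and> 0 \<le> (\<integral>t\<in>{a..b}. k t \<partial>lborel)}"
    \<comment> \<open>The covering theorem speaks of closed balls; an interval is encoded by its end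
      points, with its midpoint as centre and half its length as radius.\<close>
    let ?c = "\<lambda>i::real\<times>real. (fst i + snd i) / 2" and ?r = "\<lambda>i::real\<times>real. (snd i - fst i) / 2"
    have ball: "cball (?c i) (?r i) = {fst i..snd i}" for i
      by (auto simp: cball_eq_atLeastAtMost field_simps)
    have r0: "\<And>i. i \<in> K \<Longrightarrow> 0 < ?r i" by (auto simp: K_def)
    have vit: "\<exists>i. i \<in> K \<and> x \<in> cball (?c i) (?r i) \<and> ?r i < d" if x: "x \<in> ?E" and d: "0 < d" for x d
    proof -
      have "x \<in> U" using x U by (auto simp: T_def)
      then obtain r where r: "r > 0" "ball x r \<subseteq> U" using U(2) open_contains_ball by blast
      \<comment> \<open>\<open>min r d\<close> keeps the interval inside the ball in
        \<open>U\<close> and its radius below \<open>d\<close>.\<close>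
      obtain a b where ab: "a \<le> x" "x \<le> b" "a < b" "b - a < min r d" "0 \<le> (\<integral>t\<in>{a..b}. k t \<partial>lborel)"
        using x r(1) d by (auto dest!: spec[of _ "min r d"])
      have "{a..b} \<subseteq> ball x r" using ab by (auto simp: dist_real_def)
      then have "(a, b) \<in> K" using ab r by (auto simp: K_def)
      then show ?thesis using ab ball[of "(a,b)"] by (intro exI[of _ "(a,b)"]) auto
    qed
    obtain J where J: "countable J" "J \<subseteq> K"
      "pairwise (\<lambda>i j. disjnt (cball (?c i) (?r i)) (cball (?c j) (?r j))) J"
      "negligible (?E - (\<Union>i\<in>J. cball (?c i) (?r i)))"
      using Vitali_covering_theorem_cballs[of K ?r ?E ?c, OF r0 vit] by blast
    define V where "V = (\<Union>i\<in>J. {fst i..snd i})"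
    have disj: "disjoint_family_on (\<lambda>i. {fst i..snd i}) J"
      using J(3) unfolding ball by (auto simp: disjoint_family_on_def pairwise_def disjnt_def)
    have Vb: "V \<in> sets borel" unfolding V_def using J(1) by auto
    have "emeasure N V = (\<integral>\<^sup>+i. emeasure N {fst i..snd i} \<partial>count_space J)"
      unfolding V_def by (rule emeasure_UN_countable) (auto simp: sN J(1) disj)
    also have "\<dots> \<le> (\<integral>\<^sup>+i. emeasure P {fst i..snd i} \<partial>count_space J)"
    proof (rule nn_integral_mono)
      fix i assume "i \<in> space (count_space J)"
      then have "0 \<le> (\<integral>t\<in>{fst i..snd i}. k t \<partial>lborel)" using J(2) by (auto simp: K_def)
      then show "emeasure N {fst i..snd i} \<le> emeasure P {fst i..snd i}"
        unfolding N_def P_def by (intro set_integral_nonneg_imp_emeasure_density_le k) auto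
    qed
    also have "\<dots> = emeasure P V"
      unfolding V_def by (rule emeasure_UN_countable[symmetric]) (auto simp: sP J(1) disj)
    also have "\<dots> \<le> emeasure P U"
    proof (rule emeasure_mono)
      show "V \<subseteq> U" unfolding V_def K_def using J(2)[unfolded K_def] by fastforce
    qed (use U(2) sP in auto)
    finally have "emeasure N V \<le> ennreal e" using U(3) by simp
    moreover have "negligible (?E - V)" using J(4) unfolding ball V_def .
    ultimately show ?thesis using Vb by blast
  qed
  have "\<forall>n::nat. \<exists>V. V \<in> sets borel \<and> emeasure N V \<le> ennreal (1 / Suc n) \<and> negligible (?E - V)"
  proof
    show "\<exists>V. V \<in> sets borel \<and> emeasure N V \<le> ennreal (1 / Suc n) \<and> negligible (?E - V)" for n
      using cover[of "1 / Suc n"] by simp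
  qed
  from choice[OF this] obtain V where "\<forall>n. V n \<in> sets borel \<and> emeasure N (V n) \<le> ennreal (1 / Suc n) \<and>
    negligible (?E - V n)" ..
  then have V: "\<And>n. V n \<in> sets borel" "\<And>n. emeasure N (V n) \<le> ennreal (1 / Suc n)"
    "\<And>n. negligible (?E - V n)" by simp_all
  \<comment> \<open>\<open>N\<close> has mass at most \<open>1 / Suc n\<close> on
    \<open>V n\<close>, so it vanishes on \<open>Z\<close>; as \<open>- k\<close> is positive there,
    \<open>Z\<close> is null. A point of the set outside \<open>Z\<close> is missed by some
    \<open>V n\<close>.\<close>
  define Z where "Z = (\<Inter>n. V n) \<inter> T"
  have Zb[measurable]: "Z \<in> sets borel" unfolding Z_def using V(1) by auto
  have "emeasure N Z \<le> ennreal (1 / Suc n)" for n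
    by (rule order_trans[OF emeasure_mono V(2)]) (auto simp: Z_def sN V(1))
  moreover have "(\<lambda>n. ennreal (1 / Suc n)) \<longlonglongrightarrow> ennreal 0"
    by (intro tendsto_ennrealI LIMSEQ_Suc[OF lim_1_over_n])
  ultimately have "emeasure N Z \<le> ennreal 0" by (intro LIMSEQ_le_const) auto
  then have "(\<integral>\<^sup>+x. ennreal (- k x) * indicator Z x \<partial>lborel) = 0"
    unfolding N_def by (subst (asm) emeasure_density) auto
  then have "AE x in lborel. ennreal (- k x) * indicator Z x = 0"
    by (subst (asm) nn_integral_0_iff_AE) auto
  then have "AE x in lborel. x \<notin> Z"
    by eventually_elim (auto simp: Z_def T_def split: split_indicator_asm)
  then have "negligible Z"
    by (metis AE_iff_null_sets Zb sets_lborel negligible_iff_null_sets null_sets_completionI)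
  moreover have "negligible (\<Union>n. ?E - V n)" using V(3) by (intro negligible_Union_nat) auto
  ultimately have "negligible (Z \<union> (\<Union>n. ?E - V n))" by (rule negligible_Un)
  then show ?thesis by (rule negligible_subset) (auto simp: Z_def T_def)
qed

lemma AE_lborel_if_negligible:
  assumes "negligible S" and "\<And>x. x \<notin> S \<Longrightarrow> P x"
  shows "AE x in lborel. P x"
proof -
  have "AE x in lebesgue. x \<notin> S"
    using assms(1) by (intro AE_not_in) (simp add: negligible_iff_null_sets)
  then have "AE x in lebesgue. P x" by (rule AE_mp) (use assms(2) in auto)
  then show ?thesis by (simp add: AE_completion_iff)
qed

text \<open>If averages near \<open>x\<close> kept exceeding \<open>g x + e\<close>, then for a
  rational \<open>q\<close> strictly between \<open>g x\<close> and \<open>g x + e\<close> the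
  function \<open>g - q\<close> would be negative at \<open>x\<close> and yet have nonnegative
  averages on arbitrarily short intervals. Each such set is negligible, and there are countably
  many. Truncation to \<open>{- N<..<N}\<close> makes the constant \<open>q\<close>
  integrable.\<close>

lemma AE_integral_average_upper_bound:
  fixes g :: "real \<Rightarrow> real"
  assumes g: "integrable lborel g"
  shows "AE x in lborel. \<forall>e>0. \<exists>d>0. \<forall>a b. a \<le> x \<longrightarrow> x \<le> b \<longrightarrow> a < b \<longrightarrow> b - a < d \<longrightarrow>
    (\<integral>t\<in>{a..b}. g t \<partial>lborel) \<le> (g x + e) * (b - a)"
proof -
  define k where "k q N = (\<lambda>x. indicator {- N<..<N} x * (g x - q))" for q N :: real
  define E where "E q N = {x. k q N x < 0 \<and> (\<forall>d>0. \<exists>a b. a \<le> x \<and> x \<le> b \<and> a < b \<and> b - a < d \<and>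
      0 \<le> (\<integral>t\<in>{a..b}. k q N t \<partial>lborel))}" for q N
  have ik: "integrable lborel (k q N)" for q N
  proof -
    have "integrable lborel (\<lambda>x. indicator {- N<..<N} x *\<^sub>R q)"
      by (intro integrable_scaleR_left integrable_real_indicator) (cases "- N \<le> N"; simp)+
    moreover have "integrable lborel (\<lambda>x. indicator {- N<..<N} x *\<^sub>R g x)"
      by (rule integrable_mult_indicator[OF _ g]) simp
    ultimately have "integrable lborel (\<lambda>x. indicator {- N<..<N} x *\<^sub>R g x - indicator {- N<..<N} x *\<^sub>R q)"
      by (rule Bochner_Integration.integrable_diff[rotated])
    then show ?thesis unfolding k_def by (simp add: algebra_simps)
  qed
  have neg: "negligible (E q N)" for q N
    unfolding E_def by (rule negligible_negative_with_nonneg_averages[OF ik])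
  have negU: "negligible (\<Union>(q,n)\<in>(\<rat>\<times>(UNIV::nat set)). E q (real n))"
    by (rule negligible_countable_Union) (auto intro!: countable_SIGMA countable_rat neg)
  show ?thesis
  proof (rule AE_lborel_if_negligible[OF negU], intro allI impI)
    fix x e :: real assume x: "x \<notin> (\<Union>(q,n)\<in>(\<rat>\<times>(UNIV::nat set)). E q (real n))" and e: "0 < e"
    obtain n :: nat where n: "\<bar>x\<bar> < real n" using reals_Archimedean2 by blast
    obtain q where q: "q \<in> \<rat>" "g x < q" "q < g x + e" using Rats_dense_in_real[of "g x" "g x + e"] e by auto
    have kx: "k q n x < 0" using n q by (simp add: k_def indicator_def abs_less_iff)
    have "x \<notin> E q n" using x q(1) by auto
    then obtain d where d: "d > 0" and
      D: "\<And>a b. a \<le> x \<Longrightarrow> x \<le> b \<Longrightarrow> a < b \<Longrightarrow> b - a < d \<Longrightarrow> \<not> 0 \<le> (\<integral>t\<in>{a..b}. k q n t \<partial>lborel)"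
      using kx unfolding E_def by blast
    show "\<exists>d>0. \<forall>a b. a \<le> x \<longrightarrow> x \<le> b \<longrightarrow> a < b \<longrightarrow> b - a < d \<longrightarrow>
      (\<integral>t\<in>{a..b}. g t \<partial>lborel) \<le> (g x + e) * (b - a)"
    proof (intro exI[of _ "min d (real n - \<bar>x\<bar>)"] conjI allI impI)
      show "0 < min d (real n - \<bar>x\<bar>)" using d n by auto
      fix a b assume ab: "a \<le> x" "x \<le> b" "a < b" "b - a < min d (real n - \<bar>x\<bar>)"
      have sub: "{a..b} \<subseteq> {- real n<..<real n}" using ab by auto
      have "(\<integral>t\<in>{a..b}. k q n t \<partial>lborel) = (\<integral>t\<in>{a..b}. (g t - q) \<partial>lborel)"
        by (rule set_lebesgue_integral_cong) (use sub in \<open>auto simp: k_def\<close>)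
      also have "\<dots> = (\<integral>t\<in>{a..b}. g t \<partial>lborel) - (\<integral>t\<in>{a..b}. q \<partial>lborel)"
      proof (rule set_integral_diff(2))
        show "set_integrable lborel {a..b} g"
          unfolding set_integrable_def by (rule integrable_mult_indicator[OF _ g]) simp
        show "set_integrable lborel {a..b} (\<lambda>t. q)"
          unfolding set_integrable_def
          by (intro integrable_scaleR_left integrable_real_indicator) (use ab in simp_all)
      qed
      also have "(\<integral>t\<in>{a..b}. q \<partial>lborel) = q * (b - a)"
        using ab by (simp add: set_lebesgue_integral_def)
      finally have "(\<integral>t\<in>{a..b}. g t \<partial>lborel) \<le> q * (b - a)" using D[OF ab(1-3)] ab(4) by simp
      also have "\<dots> \<le> (g x + e) * (b - a)" using q ab by (intro mult_right_mono) auto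
      finally show "(\<integral>t\<in>{a..b}. g t \<partial>lborel) \<le> (g x + e) * (b - a)" .
    qed
  qed
qed

text \<open>The upper bound for \<open>- g\<close> is the lower bound for \<open>g\<close>. The
  intervals contain \<open>x\<close> without being centred there, so they include those with
  \<open>x\<close> as an end point, which occur in difference quotients.\<close>

theorem AE_lebesgue_differentiation:
  fixes g :: "real \<Rightarrow> real"
  assumes g: "integrable lborel g"
  shows "AE x in lborel. \<forall>e>0. \<exists>d>0. \<forall>a b. a \<le> x \<longrightarrow> x \<le> b \<longrightarrow> a < b \<longrightarrow> b - a < d \<longrightarrow>
    \<bar>(\<integral>t\<in>{a..b}. g t \<partial>lborel) - g x * (b - a)\<bar> \<le> e * (b - a)"
proof -
  have mg: "integrable lborel (\<lambda>x. - g x)" using g by simp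
  show ?thesis
    using AE_integral_average_upper_bound[OF g] AE_integral_average_upper_bound[OF mg]
  proof (eventually_elim, intro allI impI)
    fix x e :: real assume e: "0 < e"
    assume "\<forall>e>0. \<exists>d>0. \<forall>a b. a \<le> x \<longrightarrow> x \<le> b \<longrightarrow> a < b \<longrightarrow> b - a < d \<longrightarrow>
      (\<integral>t\<in>{a..b}. g t \<partial>lborel) \<le> (g x + e) * (b - a)"
    then obtain d1 where d1: "d1 > 0" "\<And>a b. a \<le> x \<Longrightarrow> x \<le> b \<Longrightarrow> a < b \<Longrightarrow> b - a < d1 \<Longrightarrow>
      (\<integral>t\<in>{a..b}. g t \<partial>lborel) \<le> (g x + e) * (b - a)" using e by blast
    assume "\<forall>e>0. \<exists>d>0. \<forall>a b. a \<le> x \<longrightarrow> x \<le> b \<longrightarrow> a < b \<longrightarrow> b - a < d \<longrightarrow>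
      (\<integral>t\<in>{a..b}. - g t \<partial>lborel) \<le> (- g x + e) * (b - a)"
    then obtain d2 where d2: "d2 > 0" "\<And>a b. a \<le> x \<Longrightarrow> x \<le> b \<Longrightarrow> a < b \<Longrightarrow> b - a < d2 \<Longrightarrow>
      (\<integral>t\<in>{a..b}. - g t \<partial>lborel) \<le> (- g x + e) * (b - a)" using e by blast
    have neg: "(\<integral>t\<in>{a..b}. - g t \<partial>lborel) = - (\<integral>t\<in>{a..b}. g t \<partial>lborel)" for a b
      by (simp add: set_lebesgue_integral_def)
    show "\<exists>d>0. \<forall>a b. a \<le> x \<longrightarrow> x \<le> b \<longrightarrow> a < b \<longrightarrow> b - a < d \<longrightarrow>
      \<bar>(\<integral>t\<in>{a..b}. g t \<partial>lborel) - g x * (b - a)\<bar> \<le> e * (b - a)"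
    proof (intro exI[of _ "min d1 d2"] conjI allI impI)
      show "0 < min d1 d2" using d1 d2 by auto
      fix a b assume ab: "a \<le> x" "x \<le> b" "a < b" "b - a < min d1 d2"
      show "\<bar>(\<integral>t\<in>{a..b}. g t \<partial>lborel) - g x * (b - a)\<bar> \<le> e * (b - a)"
        using d1(2)[OF ab(1-3)] d2(2)[OF ab(1-3)] ab(4) unfolding neg
        by (auto simp: algebra_simps abs_le_iff)
    qed
  qed
qed

lemma AE_has_real_derivative_indefinite_integral:
  fixes g F :: "real \<Rightarrow> real"
  assumes g: "integrable lborel g"
    and F: "\<And>a b. c \<le> a \<Longrightarrow> a \<le> b \<Longrightarrow> b \<le> d \<Longrightarrow> (\<integral>t\<in>{a..b}. g t \<partial>lborel) = F b - F a"
  shows "AE x in lborel. x \<in> {c<..<d} \<longrightarrow> (F has_real_derivative g x) (at x)"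
  using AE_lebesgue_differentiation[OF g]
proof (eventually_elim, intro impI)
  fix x assume L: "\<forall>e>0. \<exists>d>0. \<forall>a b. a \<le> x \<longrightarrow> x \<le> b \<longrightarrow> a < b \<longrightarrow> b - a < d \<longrightarrow>
    \<bar>(\<integral>t\<in>{a..b}. g t \<partial>lborel) - g x * (b - a)\<bar> \<le> e * (b - a)" and x: "x \<in> {c<..<d}"
  have "(\<lambda>h::real. (F (x + h) - F x) / h) \<midarrow>0\<rightarrow> g x"
  proof (rule LIM_I)
    fix r :: real assume r: "0 < r"
    \<comment> \<open>\<open>r/2\<close> turns the non-strict bound on averages into the strict one
      in the definition of the limit.\<close>
    obtain s where s: "s > 0" "\<And>a b. a \<le> x \<Longrightarrow> x \<le> b \<Longrightarrow> a < b \<Longrightarrow> b - a < s \<Longrightarrow>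
      \<bar>(\<integral>t\<in>{a..b}. g t \<partial>lborel) - g x * (b - a)\<bar> \<le> r/2 * (b - a)"
      using L r by (meson half_gt_zero)
    show "\<exists>s>0. \<forall>h::real. h \<noteq> 0 \<and> norm (h - 0) < s \<longrightarrow> norm ((F (x + h) - F x) / h - g x) < r"
    proof (intro exI[of _ "min s (min (x - c) (d - x))"] conjI allI impI)
      show "0 < min s (min (x - c) (d - x))" using s x by auto
      fix h :: real assume h: "h \<noteq> 0 \<and> norm (h - 0) < min s (min (x - c) (d - x))"
      have "\<bar>F (x + h) - F x - g x * h\<bar> \<le> r/2 * \<bar>h\<bar>"
      proof (cases "h > 0")
        case True
        then show ?thesis using s(2)[of x "x + h"] F[of x "x + h"] h x by auto
      next
        case False
        then have "\<bar>F x - F (x + h) - g x * (- h)\<bar> \<le> r/2 * (- h)"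
          using s(2)[of "x + h" x] F[of "x + h" x] h x by auto
        then show ?thesis using False by (simp add: abs_minus_commute abs_if split: if_splits)
      qed
      then have "\<bar>(F (x + h) - F x - g x * h) / h\<bar> \<le> r/2"
        using h by (simp add: abs_divide pos_divide_le_eq)
      moreover have "(F (x + h) - F x - g x * h) / h = (F (x + h) - F x) / h - g x"
        using h by (simp add: field_simps)
      ultimately show "norm ((F (x + h) - F x) / h - g x) < r" using r by simp
    qed
  qed
  then show "(F has_real_derivative g x) (at x)" by (simp add: DERIV_def)
qed

section \<open>Monotone Lipschitz functions as indefinite integrals\<close>

lemma mono_lipschitz_indefinite_integral:
  fixes F :: "real \<Rightarrow> real"
  assumes mono: "\<And>x y. x \<le> y \<Longrightarrow> F x \<le> F y"
    and lip: "\<And>x y. x \<le> y \<Longrightarrow> F y - F x \<le> L * (y - x)"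
  obtains g where "integrable lborel g"
    "\<And>a b. c \<le> a \<Longrightarrow> a \<le> b \<Longrightarrow> b \<le> d \<Longrightarrow> (\<integral>t\<in>{a..b}. g t \<partial>lborel) = F b - F a"
proof -
  define G where "G x = F x + x" for x
  define H where "H = inv G"
  have strict: "G x < G y \<longleftrightarrow> x < y" for x y
    using mono[of x y] mono[of y x] by (cases x y rule: linorder_cases) (auto simp: G_def)
  have le_iff: "G x \<le> G y \<longleftrightarrow> x \<le> y" for x y using strict[of y x] by linarith
  have inj: "inj G"
    by (rule injI) (metis le_iff order_antisym order_refl)
  have L0: "L \<ge> 0" using lip[of 0 1] mono[of 0 1] by simp
  have Flip: "\<bar>F y - F x\<bar> \<le> L * \<bar>y - x\<bar>" for x y
    using mono[of x y] mono[of y x] lip[of x y] lip[of y x] by (cases "x \<le> y") auto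
  have Glip: "\<bar>G y - G x\<bar> \<le> (L + 1) * \<bar>y - x\<bar>" for x y
  proof -
    have "G y - G x = (F y - F x) + (y - x)" by (simp add: G_def)
    moreover have "(L + 1) * \<bar>y - x\<bar> = L * \<bar>y - x\<bar> + \<bar>y - x\<bar>" by (simp add: distrib_right)
    ultimately show ?thesis using Flip[where x=x and y=y] by linarith
  qed
  have "(L + 1)-lipschitz_on UNIV G"
  proof (rule lipschitz_onI)
    show "dist (G x) (G y) \<le> (L + 1) * dist x y" for x y
      using Glip[where x = y and y = x] by (simp add: dist_real_def)
  qed (use L0 in simp)
  then have contG: "continuous_on UNIV G" by (rule lipschitz_on_continuous_on)
  have surj: "surj G"
  proof (unfold surj_def, intro allI)
    fix y
    \<comment> \<open>By monotonicity
      \<open>G (-w) \<le> F 0 - w \<le> y \<le> F 0 + w \<le> G w\<close>, which brackets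
      \<open>y\<close> for the intermediate value theorem.\<close>
    define w where "w = \<bar>y - F 0\<bar>"
    have "G (-w) \<le> y" "y \<le> G w"
      using mono[of "-w" 0] mono[of 0 w] by (auto simp: G_def w_def)
    moreover have "- w \<le> w" by (simp add: w_def)
    moreover have "continuous_on {-w..w} G" using contG continuous_on_subset by blast
    ultimately show "\<exists>x. y = G x" using IVT'[of G "-w" y w] by metis
  qed
  have HG: "H (G x) = x" and GH: "G (H y) = y" for x y
    using inj surj by (auto simp: H_def surj_f_inv_f)
  have H_le: "H y \<le> x \<longleftrightarrow> y \<le> G x" and le_H: "x \<le> H y \<longleftrightarrow> G x \<le> y" for x y
    using le_iff[of "H y" x] le_iff[of x "H y"] by (simp_all add: GH)
  have monoH: "mono H" by (rule monoI) (simp add: H_le GH)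
  have [measurable]: "H \<in> borel_measurable borel" using monoH by (rule borel_measurable_mono)
  define \<mu> where "\<mu> = distr lborel borel H"
  have ac: "absolutely_continuous lborel \<mu>"
    unfolding absolutely_continuous_def
  proof
    fix A :: "real set" assume A: "A \<in> null_sets lborel"
    then have [measurable]: "A \<in> sets borel" by auto
    have "negligible A" using A negligible_iff_null_sets null_sets_completionI by blast
    then have "negligible (G ` A)"
      by (rule negligible_locally_Lipschitz_image[rotated])
         (use Glip in \<open>auto intro!: exI[of _ UNIV]\<close>)
    moreover have "G ` A = H -` A" by (auto simp: HG) (metis GH imageI)
    moreover have "H -` A \<in> sets lborel"
      using measurable_sets[of H borel borel A] by simp
    ultimately have "H -` A \<in> null_sets lborel"
      by (simp add: negligible_iff_null_sets null_sets_completion_iff)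
    then show "A \<in> null_sets \<mu>"
      by (auto simp: \<mu>_def null_sets_def emeasure_distr)
  qed
  obtain f where f[measurable]: "f \<in> borel_measurable lborel" and df: "density lborel f = \<mu>"
    using sigma_finite_measure.Radon_Nikodym[OF sigma_finite_lborel ac] by (auto simp: \<mu>_def)
  have f_int: "(\<integral>\<^sup>+t. f t * indicator {a..b} t \<partial>lborel) = ennreal (G b - G a)" if "a \<le> b" for a b
  proof -
    have "(\<integral>\<^sup>+t. f t * indicator {a..b} t \<partial>lborel) = emeasure \<mu> {a..b}"
      unfolding df[symmetric] by (subst emeasure_density) auto
    also have "\<dots> = emeasure lborel (H -` {a..b})" by (simp add: \<mu>_def emeasure_distr)
    also have "H -` {a..b} = {G a..G b}"
by (auto simp: H_le le_H)
    also have "emeasure lborel {G a..G b} = ennreal (G b - G a)"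
      using that strict[of b a] by simp
    finally show ?thesis .
  qed
  \<comment> \<open>On \<open>{c..d}\<close> the density is infinite at most on a null set, where
    \<open>enn2real\<close> gives 0. The cut-off makes \<open>h\<close> and the subtracted 1
    integrable on the whole line.\<close>
  define h where "h t = enn2real (f t) * indicator {c..d} t" for t
  define g where "g t = h t - indicator {c..d} t" for t
  have ffin: "AE t in lborel. f t * indicator {c..d} t \<noteq> \<infinity>"
  proof (cases "c \<le> d")
    case True
    then show ?thesis by (intro nn_integral_noteq_infinite) (auto simp: f_int)
  qed auto
  have h_int: "has_bochner_integral lborel (\<lambda>t. indicator {a..b} t *\<^sub>R h t) (G b - G a)"
    if "c \<le> a" "a \<le> b" "b \<le> d" for a b
  proof (rule has_bochner_integral_nn_integral)
    have "(\<integral>\<^sup>+t. ennreal (indicator {a..b} t *\<^sub>R h t) \<partial>lborel) = (\<integral>\<^sup>+t. f t * indicator {a..b} t \<partial>lborel)"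
      by (rule nn_integral_cong_AE, use ffin in eventually_elim)
         (use that in \<open>auto simp: h_def ennreal_enn2real_if split: split_indicator\<close>)
    then show "(\<integral>\<^sup>+t. ennreal (indicator {a..b} t *\<^sub>R h t) \<partial>lborel) = ennreal (G b - G a)"
      using f_int that by simp
    show "0 \<le> G b - G a" using that strict[of b a] by simp
  qed (auto simp: h_def)
  have ih: "integrable lborel h"
  proof (cases "c \<le> d")
    case True
    have "(\<lambda>t. indicator {c..d} t *\<^sub>R h t) = h" by (auto simp: h_def split: split_indicator)
    then show ?thesis using h_int[of c d] True by (auto intro: integrable.intros)
  next
    case False
    then have "h = (\<lambda>t. 0)" by (auto simp: h_def)
    then show ?thesis by simp
  qed
  have ig: "integrable lborel g"
    unfolding g_def
    by (intro Bochner_Integration.integrable_diff ih integrable_real_indicator) (cases "c \<le> d"; simp)+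
  moreover have "(\<integral>t\<in>{a..b}. g t \<partial>lborel) = F b - F a" if "c \<le> a" "a \<le> b" "b \<le> d" for a b
  proof -
    have "(\<integral>t\<in>{a..b}. g t \<partial>lborel) = (\<integral>t. indicator {a..b} t *\<^sub>R h t - indicator {a..b} t \<partial>lborel)"
      unfolding set_lebesgue_integral_def g_def
      by (rule Bochner_Integration.integral_cong) (use that in \<open>auto split: split_indicator\<close>)
    also have "\<dots> = (\<integral>t. indicator {a..b} t *\<^sub>R h t \<partial>lborel) - (\<integral>t. indicator {a..b} t \<partial>lborel)"
    proof (rule Bochner_Integration.integral_diff)
      show "integrable lborel (\<lambda>t. indicator {a..b} t *\<^sub>R h t)"
        using h_int[OF that] by (simp add: has_bochner_integral_iff)
      show "integrable lborel (\<lambda>t. indicator {a..b} t :: real)"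
        by (rule integrable_real_indicator) (use that in simp_all)
    qed
    also have "\<dots> = G b - G a - (b - a)"
      using h_int[OF that] that by (simp add: has_bochner_integral_iff)
    finally show ?thesis by (simp add: G_def)
  qed
  ultimately show ?thesis using that by blast
qed

section \<open>Borel measurability of derivatives\<close>

text \<open>The Cauchy criterion avoids naming the limit, and rational increments leave countably
  many conditions, so the set of points of differentiability is Borel. Rational increments suffice
  because difference quotients of a continuous function are continuous in the increment away from
  0.\<close>

lemma real_differentiable_iff_rational_Cauchy:
  fixes F :: "real \<Rightarrow> real"
  assumes cont: "continuous_on UNIV F"
  defines "Q \<equiv> \<lambda>h t. (F (t + h) - F t) / h"
  shows "F field_differentiable at t \<longleftrightarrow>
    (\<forall>k::nat. \<exists>m::nat. \<forall>(p::rat) (q::rat). p \<noteq> 0 \<longrightarrow> q \<noteq> 0 \<longrightarrow>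
      \<bar>real_of_rat p\<bar> < 1 / Suc m \<longrightarrow> \<bar>real_of_rat q\<bar> < 1 / Suc m \<longrightarrow>
      \<bar>Q (real_of_rat p) t - Q (real_of_rat q) t\<bar> \<le> 1 / Suc k)" (is "_ \<longleftrightarrow> ?R")
proof
  assume "F field_differentiable at t"
  then obtain d where "(F has_real_derivative d) (at t)" by (auto simp: field_differentiable_def)
  then have lim: "(\<lambda>h. Q h t) \<midarrow>0\<rightarrow> d" by (simp add: DERIV_def Q_def)
  show ?R
  proof
    fix k :: nat
    define e where "e = 1 / real (Suc k)"
    have "0 < e / 2" by (simp add: e_def)
    from LIM_D[OF lim this] obtain s where s: "s > 0"
      "\<And>h. h \<noteq> 0 \<Longrightarrow> \<bar>h\<bar> < s \<Longrightarrow> \<bar>Q h t - d\<bar> < e / 2" by auto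
    obtain m :: nat where m: "1 / Suc m < s" using nat_approx_posE[OF s(1)] by blast
    have "\<bar>Q (real_of_rat p) t - Q (real_of_rat q) t\<bar> \<le> e"
      if "p \<noteq> 0" "q \<noteq> 0" "\<bar>real_of_rat p\<bar> < 1 / Suc m" "\<bar>real_of_rat q\<bar> < 1 / Suc m" for p q
    proof -
      have "\<bar>Q (real_of_rat p) t - d\<bar> < e / 2" and "\<bar>Q (real_of_rat q) t - d\<bar> < e / 2"
        by (rule s(2); use that m in simp)+
      then show ?thesis by linarith
    qed
    then show "\<exists>m::nat. \<forall>(p::rat) (q::rat). p \<noteq> 0 \<longrightarrow> q \<noteq> 0 \<longrightarrow>
      \<bar>real_of_rat p\<bar> < 1 / Suc m \<longrightarrow> \<bar>real_of_rat q\<bar> < 1 / Suc m \<longrightarrow>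
      \<bar>Q (real_of_rat p) t - Q (real_of_rat q) t\<bar> \<le> 1 / Suc k"
      unfolding e_def by blast
  qed
next
  assume R: ?R
  \<comment> \<open>The candidate limit is taken along the increments \<open>1 / Suc n\<close>,
    which are rational; \<open>n > m\<close> makes them strictly smaller than
    \<open>1 / Suc m\<close>.\<close>
  define c where "c n = Q (1 / Suc n) t" for n
  have rat_c: "c n = Q (real_of_rat (1 / of_nat (Suc n))) t" for n
    by (simp add: c_def of_rat_divide del: of_nat_Suc)
  have est: "\<exists>m::nat. (\<forall>p::rat. \<forall>n>m. p \<noteq> 0 \<longrightarrow> \<bar>real_of_rat p\<bar> < 1 / Suc m \<longrightarrow>
      \<bar>Q (real_of_rat p) t - c n\<bar> \<le> 1 / Suc k)" for k
  proof -
    obtain m :: nat where m: "\<And>p q::rat. p \<noteq> 0 \<Longrightarrow> q \<noteq> 0 \<Longrightarrow>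
      \<bar>real_of_rat p\<bar> < 1 / Suc m \<Longrightarrow> \<bar>real_of_rat q\<bar> < 1 / Suc m \<Longrightarrow>
      \<bar>Q (real_of_rat p) t - Q (real_of_rat q) t\<bar> \<le> 1 / Suc k" using R by meson
    show ?thesis
    proof (intro exI[of _ m] allI impI)
      fix p :: rat and n assume "m < n" "p \<noteq> 0" "\<bar>real_of_rat p\<bar> < 1 / Suc m"
      then show "\<bar>Q (real_of_rat p) t - c n\<bar> \<le> 1 / Suc k"
        unfolding rat_c by (intro m) (auto simp: of_rat_divide frac_less2 simp del: of_nat_Suc)
    qed
  qed
  have "Cauchy c"
  proof (rule metric_CauchyI)
    fix e :: real assume "0 < e"
    then obtain k where k: "1 / Suc k < e" using nat_approx_posE by blast
    obtain m where m: "\<And>(p::rat) n. n > m \<Longrightarrow> p \<noteq> 0 \<Longrightarrow> \<bar>real_of_rat p\<bar> < 1 / Suc m \<Longrightarrow>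
      \<bar>Q (real_of_rat p) t - c n\<bar> \<le> 1 / Suc k" using est by meson
    have "dist (c i) (c j) < e" if "i \<ge> Suc m" "j \<ge> Suc m" for i j
    proof -
      have "\<bar>c i - c j\<bar> \<le> 1 / Suc k"
        unfolding rat_c[of i] using that
        by (intro m) (auto simp: of_rat_divide frac_less2 simp del: of_nat_Suc)
      then show ?thesis using k by (simp add: dist_real_def)
    qed
    then show "\<exists>M. \<forall>i\<ge>M. \<forall>j\<ge>M. dist (c i) (c j) < e" by blast
  qed
  then obtain L where L: "c \<longlonglongrightarrow> L" by (auto simp: Cauchy_convergent_iff convergent_def)
  have "(\<lambda>h. Q h t) \<midarrow>0\<rightarrow> L"
  proof (rule LIM_I)
    fix e :: real assume "0 < e"
    then obtain k where k: "1 / Suc k < e" using nat_approx_posE by blast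
    obtain m where m: "\<And>(p::rat) n. n > m \<Longrightarrow> p \<noteq> 0 \<Longrightarrow> \<bar>real_of_rat p\<bar> < 1 / Suc m \<Longrightarrow>
      \<bar>Q (real_of_rat p) t - c n\<bar> \<le> 1 / Suc k" using est by meson
    have rat: "\<bar>Q (real_of_rat p) t - L\<bar> \<le> 1 / Suc k" if "p \<noteq> 0" "\<bar>real_of_rat p\<bar> < 1 / Suc m" for p
    proof (rule tendsto_upperbound)
      show "(\<lambda>n. \<bar>Q (real_of_rat p) t - c n\<bar>) \<longlonglongrightarrow> \<bar>Q (real_of_rat p) t - L\<bar>"
        by (intro tendsto_intros L)
      show "\<forall>\<^sub>F n in sequentially. \<bar>Q (real_of_rat p) t - c n\<bar> \<le> 1 / Suc k"
        using eventually_gt_at_top[of m] by eventually_elim (use m that in auto)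
    qed simp
    have "\<bar>Q h t - L\<bar> \<le> 1 / Suc k" if h: "h \<noteq> 0" "\<bar>h\<bar> < 1 / Suc m" for h
    \<comment> \<open>A violation at a real increment persists in a neighbourhood of it, which
      contains a rational increment and contradicts \<open>rat\<close>.\<close>
    proof (rule ccontr)
      assume "\<not> \<bar>Q h t - L\<bar> \<le> 1 / Suc k"
      then have gt: "1 / Suc k < \<bar>Q h t - L\<bar>" by simp
      have "isCont F x" for x using cont by (simp add: continuous_on_eq_continuous_at)
      have "isCont (\<lambda>h. F (t + h)) h"
        by (rule isCont_o2[where f = "\<lambda>h. t + h" and g = F]) (simp_all add: \<open>\<And>x. isCont F x\<close>)
      then have "isCont (\<lambda>h. \<bar>Q h t - L\<bar>) h"
        unfolding Q_def using h by (intro continuous_intros) auto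
      then have "\<forall>\<^sub>F x in at h. 1 / Suc k < \<bar>Q x t - L\<bar>"
        using gt unfolding isCont_def by (rule order_tendstoD)
      moreover have "\<forall>\<^sub>F x in at h. x \<noteq> 0"
        using h(1) by (rule tendsto_imp_eventually_ne[OF tendsto_ident_at])
      moreover have "\<forall>\<^sub>F x in at h. \<bar>x\<bar> < 1 / Suc m"
        using h(2) by (intro order_tendstoD(2)[OF tendsto_rabs[OF tendsto_ident_at]])
      ultimately have "\<forall>\<^sub>F x in at h. 1 / Suc k < \<bar>Q x t - L\<bar> \<and> x \<noteq> 0 \<and> \<bar>x\<bar> < 1 / Suc m"
        by eventually_elim simp
      then obtain s where s: "s > 0" "\<And>x. x \<noteq> h \<Longrightarrow> dist x h < s \<Longrightarrow>
        1 / Suc k < \<bar>Q x t - L\<bar> \<and> x \<noteq> 0 \<and> \<bar>x\<bar> < 1 / Suc m"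
        unfolding eventually_at by blast
      obtain r where r: "h < real_of_rat r" "real_of_rat r < h + s"
        using of_rat_dense[of h "h + s"] s(1) by auto
      then have "1 / Suc k < \<bar>Q (real_of_rat r) t - L\<bar> \<and> real_of_rat r \<noteq> 0 \<and> \<bar>real_of_rat r\<bar> < 1 / Suc m"
        by (intro s(2)) (auto simp: dist_real_def)
      then show False using rat[of r] by auto
    qed
    then show "\<exists>s>0. \<forall>h. h \<noteq> 0 \<and> norm (h - 0) < s \<longrightarrow> norm (Q h t - L) < e"
      using k by (intro exI[of _ "1 / Suc m"]) force
  qed
  then show "F field_differentiable at t"
    by (auto simp: field_differentiable_def DERIV_def Q_def)
qed

text \<open>
  The integral in the fold product is over \<^const>\<open>lborel\<close>, which is not complete, so
  almost-everywhere measurability would not do: a derivative that is not Borel would make the integral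
  \<open>0\<close>. Borel measurability holds because the junk value of \<^const>\<open>deriv\<close> does not depend on the
  point.
\<close>

lemma borel_measurable_deriv:
  fixes F :: "real \<Rightarrow> real"
  assumes cont: "continuous_on UNIV F"
  shows "deriv F \<in> borel_measurable borel"
proof -
  define Q where "Q h t = (F (t + h) - F t) / h" for h t
  have [measurable]: "F \<in> borel_measurable borel"
    using cont by (rule borel_measurable_continuous_onI)
  have [measurable]: "Q h \<in> borel_measurable borel" for h
    unfolding Q_def by measurable
  define D where "D = {t. F field_differentiable at t}"
  have "D = {t \<in> space borel. \<forall>k::nat. \<exists>m::nat. \<forall>(p::rat) (q::rat). p \<noteq> 0 \<longrightarrow> q \<noteq> 0 \<longrightarrow>
      \<bar>real_of_rat p\<bar> < 1 / Suc m \<longrightarrow> \<bar>real_of_rat q\<bar> < 1 / Suc m \<longrightarrow>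
      \<bar>Q (real_of_rat p) t - Q (real_of_rat q) t\<bar> \<le> 1 / Suc k}"
    unfolding D_def Q_def using real_differentiable_iff_rational_Cauchy[OF cont] by simp
  also have "\<dots> \<in> sets borel" by measurable
  finally have [measurable]: "D \<in> sets borel" .
  have "deriv F t = (if t \<in> D then lim (\<lambda>n. Q (1 / Suc n) t) else (SOME x. False))" for t
  proof (cases "t \<in> D")
    case True
    then have "(F has_real_derivative deriv F t) (at t)"
      by (simp add: D_def DERIV_deriv_iff_field_differentiable)
    then have "(\<lambda>h. Q h t) \<midarrow>0\<rightarrow> deriv F t" by (simp add: DERIV_def Q_def)
    moreover have "filterlim (\<lambda>n. 1 / real (Suc n)) (at 0) sequentially"
      unfolding filterlim_at by (intro conjI LIMSEQ_Suc[OF lim_1_over_n]) auto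
    ultimately have "(\<lambda>n. Q (1 / Suc n) t) \<longlonglongrightarrow> deriv F t" by (rule filterlim_compose)
    then show ?thesis using True by (simp add: limI)
  next
    case False
    then have "\<not> (F has_real_derivative d) (at t)" for d
      by (auto simp: D_def field_differentiable_def)
    then show ?thesis using False by (simp add: deriv_def)
  qed
  then have eq: "deriv F = (\<lambda>t. if t \<in> D then lim (\<lambda>n. Q (1 / Suc n) t) else (SOME x. False))" by blast
  show ?thesis unfolding eq by measurable
qed

text \<open>Clamping the argument to \<open>{0..1}\<close> extends \<open>f\<close> continuously to
  the line and changes no germ inside the open interval, hence no derivative there.\<close>

lemma borel_measurable_deriv_unit_interval:
  fixes f :: "real \<Rightarrow> real"
  assumes f: "continuous_on {0..1} f"
  shows "(\<lambda>t. indicator {0<..<1} t * deriv f t) \<in> borel_measurable borel"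
proof -
  define F where "F t = f (max 0 (min 1 t))" for t
  have "continuous_on UNIV F"
    unfolding F_def by (rule continuous_on_compose2[OF f]) (auto intro!: continuous_intros)
  then have [measurable]: "deriv F \<in> borel_measurable borel" by (rule borel_measurable_deriv)
  have "deriv f t = deriv F t" if "t \<in> {0<..<1}" for t
  proof (rule deriv_cong_ev)
    have "\<forall>\<^sub>F x in nhds t. x \<in> {0<..<1}" using that by (intro eventually_nhds_in_open) auto
    then show "\<forall>\<^sub>F x in nhds t. f x = F x" by eventually_elim (simp add: F_def)
  qed simp
  then have "(\<lambda>t. indicator {0<..<1} t * deriv f t) = (\<lambda>t. indicator {0<..<1} t * deriv F t)"
    by (auto split: split_indicator)
  then show ?thesis by simp
qed

section \<open>Increasing nonexpansive functions on the unit interval\<close>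

definition incr_nonexpansive :: "(real \<Rightarrow> real) \<Rightarrow> bool" where
  "incr_nonexpansive f \<longleftrightarrow>
     (\<forall>x y. 0 \<le> x \<longrightarrow> x \<le> y \<longrightarrow> y \<le> 1 \<longrightarrow> f x \<le> f y \<and> f y - f x \<le> y - x)"

lemma incr_nonexpansiveD:
  assumes "incr_nonexpansive f" "0 \<le> x" "x \<le> y" "y \<le> 1"
  shows "f x \<le> f y" "f y - f x \<le> y - x"
  using assms unfolding incr_nonexpansive_def by blast+

lemma incr_nonexpansive_continuous:
  assumes f: "incr_nonexpansive f"
  shows "continuous_on {0..1} f"
proof (rule lipschitz_on_continuous_on)
  show "1-lipschitz_on {0..1} f"
  proof (rule lipschitz_onI)
    fix x y :: real assume "x \<in> {0..1}" "y \<in> {0..1}"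
    then show "dist (f x) (f y) \<le> 1 * dist x y"
      using incr_nonexpansiveD[OF f, of x y] incr_nonexpansiveD[OF f, of y x]
      by (cases "x \<le> y") (auto simp: dist_real_def)
  qed simp
qed

lemma has_real_derivative_bounds_of_incr_nonexpansive:
  assumes f: "incr_nonexpansive f" and t: "t \<in> {0<..<1}" and d: "(f has_real_derivative d) (at t)"
  shows "0 \<le> d \<and> d \<le> 1"
proof -
  have lim: "((\<lambda>y. (f y - f t) / (y - t)) \<longlongrightarrow> d) (at_right t)"
    using d unfolding has_field_derivative_iff by (rule tendsto_mono[rotated]) (simp add: at_le)
  have "\<forall>\<^sub>F y in at_right t. y \<in> {t<..<1}" using t by (intro eventually_at_right_real) simp
  then have ev: "\<forall>\<^sub>F y in at_right t. 0 \<le> (f y - f t) / (y - t) \<and> (f y - f t) / (y - t) \<le> 1"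
  proof eventually_elim
    fix y assume "y \<in> {t<..<1}"
    then show "0 \<le> (f y - f t) / (y - t) \<and> (f y - f t) / (y - t) \<le> 1"
      using incr_nonexpansiveD[OF f, of t y] t by (auto simp: divide_le_eq)
  qed
  have nt: "at_right t \<noteq> bot" by simp
  show ?thesis
    using tendsto_lowerbound[OF lim _ nt] tendsto_upperbound[OF lim _ nt] ev
    by (simp add: eventually_conj_iff)
qed

text \<open>The clamped extension is monotone and 1-Lipschitz on the line, and its density agrees
  almost everywhere with \<open>deriv f\<close>. The last claim integrates over \<open>{..b}\<close>
  so that it reads as the distribution function of the measure with density \<open>deriv f\<close>
  on the unit interval.\<close>

lemma incr_nonexpansive_deriv:
  assumes f: "incr_nonexpansive f"
  shows "AE t in lborel. t \<in> {0<..<1} \<longrightarrow>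
      (f has_real_derivative deriv f t) (at t) \<and> 0 \<le> deriv f t \<and> deriv f t \<le> 1" (is ?AE)
    and "integrable lborel (\<lambda>t. indicator {0<..<1} t * deriv f t)" (is ?int)
    and "\<And>b. 0 \<le> b \<Longrightarrow> b \<le> 1 \<Longrightarrow>
      (\<integral>t. indicator {..b} t * (indicator {0<..<1} t * deriv f t) \<partial>lborel) = f b - f 0"
proof -
  define F where "F t = f (max 0 (min 1 t))" for t
  have "F x \<le> F y" "F y - F x \<le> 1 * (y - x)" if "x \<le> y" for x y
  proof -
    let ?x = "max 0 (min 1 x)" and ?y = "max 0 (min 1 y)"
    have "0 \<le> ?x" "?x \<le> ?y" "?y \<le> 1" "?y - ?x \<le> y - x" using that by (auto simp: max_def min_def)
    then show "F x \<le> F y" "F y - F x \<le> 1 * (y - x)"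
      using incr_nonexpansiveD[OF f, of ?x ?y] unfolding F_def mult_1 by linarith+
  qed
  then obtain g where g: "integrable lborel g"
    "\<And>a b. 0 \<le> a \<Longrightarrow> a \<le> b \<Longrightarrow> b \<le> 1 \<Longrightarrow> (\<integral>t\<in>{a..b}. g t \<partial>lborel) = F b - F a"
    using mono_lipschitz_indefinite_integral[of F 1 0 1] by blast
  have Ff: "F b = f b" if "0 \<le> b" "b \<le> 1" for b using that by (simp add: F_def)
  have "(\<integral>t\<in>{a..b}. g t \<partial>lborel) = f b - f a" if "0 \<le> a" "a \<le> b" "b \<le> 1" for a b
    using g(2)[OF that] that by (simp add: Ff)
  then have der: "AE t in lborel. t \<in> {0<..<1} \<longrightarrow> (f has_real_derivative g t) (at t)"
    by (rule AE_has_real_derivative_indefinite_integral[OF g(1)])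
  then show ?AE
  proof eventually_elim
    case (elim t)
    then show ?case
      using has_real_derivative_bounds_of_incr_nonexpansive[OF f, of t "g t"] by (auto simp: DERIV_imp_deriv)
  qed
  note m = borel_measurable_deriv_unit_interval[OF incr_nonexpansive_continuous[OF f]]
  have bdd: "AE t in lborel. norm (indicator {0<..<1} t * deriv f t) \<le> norm (indicator {0<..<1} t :: real)"
    using \<open>?AE\<close> by eventually_elim (auto split: split_indicator)
  show ?int
    by (rule Bochner_Integration.integrable_bound[OF _ _ bdd]) (use m in auto)
  fix b :: real assume b: "0 \<le> b" "b \<le> 1"
  \<comment> \<open>The end points 0 and 1 are set aside because \<open>{0..b}\<close> may contain
    them and the open interval does not.\<close>
  have "AE t in lborel. indicator {..b} t * (indicator {0<..<1} t * deriv f t) = indicator {0..b} t *\<^sub>R g t"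
    using der AE_lborel_singleton[of 0] AE_lborel_singleton[of 1]
    by eventually_elim (use b in \<open>auto split: split_indicator simp: DERIV_imp_deriv\<close>)
  then have "(\<integral>t. indicator {..b} t * (indicator {0<..<1} t * deriv f t) \<partial>lborel) =
    (\<integral>t. indicator {0..b} t *\<^sub>R g t \<partial>lborel)"
    by (rule integral_cong_AE[rotated 2]) (use m g(1) in auto)
  also have "\<dots> = f b - f 0"
    using g(2)[of 0 b] b Ff by (simp add: set_lebesgue_integral_def)
  finally show "(\<integral>t. indicator {..b} t * (indicator {0<..<1} t * deriv f t) \<partial>lborel) = f b - f 0" .
qed

section \<open>The fold product and powers of copulas\<close>

text \<open>The fold product with its outer arguments frozen. It applies to any two functions of one
  variable, such as differences of sections, which are not sections of copulas.\<close>

definition deriv_pairing :: "(real \<Rightarrow> real) \<Rightarrow> (real \<Rightarrow> real) \<Rightarrow> real" where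
  "deriv_pairing f g = (LBINT t=0..1. deriv f t * deriv g t)"

lemma fold_product_eq_deriv_pairing: "fold_product A B x y = deriv_pairing (A x) (\<lambda>s. B s y)"
  by (simp add: fold_product_def deriv_pairing_def)

lemma deriv_pairing_eq:
  "deriv_pairing f g = (\<integral>t. (indicator {0<..<1} t * deriv f t) * (indicator {0<..<1} t * deriv g t) \<partial>lborel)"
proof -
  have "einterval 0 1 = {0<..<1::real}"
    by (auto simp: einterval_def zero_ereal_def one_ereal_def)
  then show ?thesis
    unfolding deriv_pairing_def interval_lebesgue_integral_def set_lebesgue_integral_def
    by (auto intro!: Bochner_Integration.integral_cong split: split_indicator)
qed

lemma deriv_pairing_commute: "deriv_pairing f g = deriv_pairing g f"
  by (simp add: deriv_pairing_def mult.commute)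

text \<open>Agreement on an open set gives equal germs, so \<open>deriv\<close> agrees even where it
  is unspecified. This permits rewriting inside a pairing with identities valid only on the unit
  square.\<close>

lemma deriv_pairing_cong:
  assumes "\<And>t. t \<in> {0<..<1} \<Longrightarrow> f t = f' t"
  shows "deriv_pairing f g = deriv_pairing f' g"
proof -
  have "deriv f t = deriv f' t" if "t \<in> {0<..<1}" for t
  proof (rule deriv_cong_ev)
    have "\<forall>\<^sub>F x in nhds t. x \<in> {0<..<1}" using that by (intro eventually_nhds_in_open) auto
    then show "\<forall>\<^sub>F x in nhds t. f x = f' x" by eventually_elim (rule assms)
  qed simp
  then have "indicator {0<..<1} t * deriv f t = indicator {0<..<1} t * deriv f' t" for t :: real
    by (simp split: split_indicator)
  then show ?thesis unfolding deriv_pairing_eq by (simp only:)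
qed

lemma deriv_pairing_integrable:
  assumes f: "incr_nonexpansive f" and g: "incr_nonexpansive g"
  shows "integrable lborel (\<lambda>t. (indicator {0<..<1} t * deriv f t) * (indicator {0<..<1} t * deriv g t))"
proof (rule Bochner_Integration.integrable_bound[OF incr_nonexpansive_deriv(2)[OF f]])
  show "AE t in lborel. norm ((indicator {0<..<1} t * deriv f t) * (indicator {0<..<1} t * deriv g t))
      \<le> norm (indicator {0<..<1} t * deriv f t)"
    using incr_nonexpansive_deriv(1)[OF f] incr_nonexpansive_deriv(1)[OF g]
    by eventually_elim (auto split: split_indicator intro: mult_left_le)
qed (use borel_measurable_integrable[OF incr_nonexpansive_deriv(2)[OF f]]
      borel_measurable_integrable[OF incr_nonexpansive_deriv(2)[OF g]] in simp)

text \<open>\<open>deriv\<close> is additive only where all summands are differentiable; a finite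
  union of null sets is discarded.\<close>

lemma deriv_pairing_sum_left:
  assumes f: "\<And>i. i \<in> I \<Longrightarrow> incr_nonexpansive (f i)" and g: "incr_nonexpansive g" and I: "finite I"
  shows "deriv_pairing (\<lambda>t. \<Sum>i\<in>I. c i * f i t) g = (\<Sum>i\<in>I. c i * deriv_pairing (f i) g)"
proof -
  let ?d = "\<lambda>f t. indicator {0<..<1} t * deriv f t :: real"
  let ?F = "\<lambda>t. \<Sum>i\<in>I. c i * f i t"
  \<comment> \<open>The coefficients are arbitrary, so \<open>?F\<close> may leave the class of
    increasing nonexpansive functions; measurability of its derivative comes from
    continuity.\<close>
  have "continuous_on {0..1} ?F"
    by (intro continuous_intros incr_nonexpansive_continuous f)
  then have Fm: "?d ?F \<in> borel_measurable borel"
    by (rule borel_measurable_deriv_unit_interval)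
  have gm: "?d g \<in> borel_measurable borel"
    using borel_measurable_integrable[OF incr_nonexpansive_deriv(2)[OF g]] by simp
  have fg: "integrable lborel (\<lambda>t. c i * (?d (f i) t * ?d g t))" if "i \<in> I" for i
    by (intro integrable_mult_right deriv_pairing_integrable f g that)
  have "AE t in lborel. \<forall>i\<in>I. t \<in> {0<..<1} \<longrightarrow> (f i has_real_derivative deriv (f i) t) (at t)"
  proof (rule AE_finite_allI[OF I])
    fix i assume "i \<in> I"
    show "AE t in lborel. t \<in> {0<..<1} \<longrightarrow> (f i has_real_derivative deriv (f i) t) (at t)"
      using incr_nonexpansive_deriv(1)[OF f[OF \<open>i \<in> I\<close>]] by eventually_elim simp
  qed
  then have "AE t in lborel. ?d ?F t * ?d g t = (\<Sum>i\<in>I. c i * (?d (f i) t * ?d g t))"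
  proof eventually_elim
    case (elim t)
    show ?case
    proof (cases "t \<in> {0<..<1}")
      case True
      then have "(?F has_real_derivative (\<Sum>i\<in>I. c i * deriv (f i) t)) (at t)"
        using elim by (intro DERIV_sum DERIV_cmult) auto
      then have "deriv ?F t = (\<Sum>i\<in>I. c i * deriv (f i) t)" by (rule DERIV_imp_deriv)
      then show ?thesis using True by (simp add: sum_distrib_right mult.assoc)
    qed simp
  qed
  then have "deriv_pairing ?F g = (\<integral>t. (\<Sum>i\<in>I. c i * (?d (f i) t * ?d g t)) \<partial>lborel)"
    unfolding deriv_pairing_eq 
  proof (rule integral_cong_AE[rotated 2])
    show "(\<lambda>t. ?d ?F t * ?d g t) \<in> borel_measurable lborel"
      using borel_measurable_times[OF Fm gm] by simp
    show "(\<lambda>t. \<Sum>i\<in>I. c i * (?d (f i) t * ?d g t)) \<in> borel_measurable lborel"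
      by (intro borel_measurable_sum borel_measurable_integrable fg)
  qed
  also have "\<dots> = (\<Sum>i\<in>I. \<integral>t. c i * (?d (f i) t * ?d g t) \<partial>lborel)"
    by (intro Bochner_Integration.integral_sum fg)
  also have "\<dots> = (\<Sum>i\<in>I. c i * deriv_pairing (f i) g)"
    by (simp add: deriv_pairing_eq)
  finally show ?thesis .
qed

lemma deriv_pairing_lincomb_left:
  assumes "incr_nonexpansive f1" "incr_nonexpansive f2" "incr_nonexpansive g"
  shows "deriv_pairing (\<lambda>t. a * f1 t + b * f2 t) g = a * deriv_pairing f1 g + b * deriv_pairing f2 g"
  using deriv_pairing_sum_left[of "UNIV :: bool set" "\<lambda>i. if i then f1 else f2" g "\<lambda>i. if i then a else b"]
    assms by (simp add: UNIV_bool add.commute)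

lemma deriv_pairing_lincomb_right:
  assumes "incr_nonexpansive f1" "incr_nonexpansive f2" "incr_nonexpansive g"
  shows "deriv_pairing g (\<lambda>t. a * f1 t + b * f2 t) = a * deriv_pairing g f1 + b * deriv_pairing g f2"
  using deriv_pairing_lincomb_left[OF assms] by (simp add: deriv_pairing_commute)

text \<open>The derivative of \<open>min s v\<close> is the indicator of \<open>{..v}\<close> except
  at \<open>v\<close>, so the pairing cuts the integral of \<open>deriv f\<close> off at
  \<open>v\<close>. This is the unit law for \<open>M\<close>.\<close>

lemma deriv_pairing_min:
  assumes f: "incr_nonexpansive f" and v: "0 \<le> v" "v \<le> 1"
  shows "deriv_pairing f (\<lambda>s. min s v) = f v - f 0"
proof -
  have d: "deriv (\<lambda>s. min s v) t = indicator {..v} t" if "t \<noteq> v" for t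
  proof -
    have "((\<lambda>s. min s v) has_real_derivative indicator {..v} t) (at t)"
    proof (cases "t < v")
      case True
      then have "\<forall>\<^sub>F s in nhds t. min s v = s"
        by (intro eventually_mono[OF eventually_nhds_in_open[of "{..<v}"]]) auto
      then have "((\<lambda>s. min s v) has_real_derivative 1) (at t) \<longleftrightarrow> ((\<lambda>s. s) has_real_derivative 1) (at t)"
        by (intro DERIV_cong_ev refl)
      then show ?thesis using True by simp
    next
      case False
      then have "t > v" using that by simp
      then have "\<forall>\<^sub>F s in nhds t. min s v = v"
        by (intro eventually_mono[OF eventually_nhds_in_open[of "{v<..}"]]) auto
      then have "((\<lambda>s. min s v) has_real_derivative 0) (at t) \<longleftrightarrow> ((\<lambda>s. v) has_real_derivative 0) (at t)"
        by (intro DERIV_cong_ev refl)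
      then show ?thesis using \<open>t > v\<close> by simp
    qed
    then show ?thesis by (rule DERIV_imp_deriv)
  qed
  have "AE t in lborel. (indicator {0<..<1} t * deriv f t) * (indicator {0<..<1} t * deriv (\<lambda>s. min s v) t)
      = indicator {..v} t * (indicator {0<..<1} t * deriv f t)"
    using AE_lborel_singleton[of v] by eventually_elim (simp add: d split: split_indicator)
  moreover have "(\<lambda>t. indicator {0<..<1} t * deriv (\<lambda>s. min s v) t) \<in> borel_measurable borel"
    by (intro borel_measurable_deriv_unit_interval continuous_intros)
  moreover have "(\<lambda>t. indicator {0<..<1} t * deriv f t) \<in> borel_measurable borel"
    using borel_measurable_integrable[OF incr_nonexpansive_deriv(2)[OF f]] by simp
  ultimately have "deriv_pairing f (\<lambda>s. min s v) =
      (\<integral>t. indicator {..v} t * (indicator {0<..<1} t * deriv f t) \<partial>lborel)"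
    unfolding deriv_pairing_eq by (intro integral_cong_AE) auto
  then show ?thesis using incr_nonexpansive_deriv(3)[OF f v] by simp
qed

text \<open>Against a linear function only the total increment of \<open>f\<close> is seen, which is
  why \<open>\<Pi>\<close> is a null element.\<close>

lemma deriv_pairing_mult_right:
  assumes f: "incr_nonexpansive f"
  shows "deriv_pairing f (\<lambda>s. s * v) = v * (f 1 - f 0)"
proof -
  have "deriv (\<lambda>s. s * v) t = v" for t
    by (rule DERIV_imp_deriv) (auto intro!: derivative_eq_intros)
  then have "deriv_pairing f (\<lambda>s. s * v) =
      (\<integral>t. v * (indicator {..1} t * (indicator {0<..<1} t * deriv f t)) \<partial>lborel)"
    unfolding deriv_pairing_eq
    by (intro Bochner_Integration.integral_cong) (auto split: split_indicator)
  then show ?thesis using incr_nonexpansive_deriv(3)[OF f, of 1] by simp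
qed

text \<open>Almost everywhere \<open>deriv f\<close> lies between 0 and 1, so the integrand lies
  between 0 and \<open>deriv g\<close>.\<close>

lemma deriv_pairing_bounds:
  assumes f: "incr_nonexpansive f" and g: "incr_nonexpansive g"
  shows "0 \<le> deriv_pairing f g" "deriv_pairing f g \<le> g 1 - g 0"
proof -
  let ?d = "\<lambda>f t. indicator {0<..<1} t * deriv f t :: real"
  show "0 \<le> deriv_pairing f g"
    unfolding deriv_pairing_eq
  proof (rule integral_nonneg_AE)
    show "AE t in lborel. 0 \<le> ?d f t * ?d g t"
      using incr_nonexpansive_deriv(1)[OF f] incr_nonexpansive_deriv(1)[OF g]
      by eventually_elim (auto split: split_indicator)
  qed
  have "deriv_pairing f g \<le> (\<integral>t. ?d g t \<partial>lborel)"
    unfolding deriv_pairing_eq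
  proof (rule integral_mono_AE[OF deriv_pairing_integrable[OF f g] incr_nonexpansive_deriv(2)[OF g]])
    show "AE t in lborel. ?d f t * ?d g t \<le> ?d g t"
      using incr_nonexpansive_deriv(1)[OF f] incr_nonexpansive_deriv(1)[OF g]
      by eventually_elim (auto split: split_indicator intro: mult_left_le_one_le)
  qed
  also have "\<dots> = (\<integral>t. indicator {..1} t * ?d g t \<partial>lborel)"
    by (rule Bochner_Integration.integral_cong) (auto split: split_indicator)
  also have "\<dots> = g 1 - g 0" using incr_nonexpansive_deriv(3)[OF g, of 1] by simp
  finally show "deriv_pairing f g \<le> g 1 - g 0" .
qed

section \<open>Sections of copulas\<close>

lemma is_copula_boundary:
  assumes "is_copula C" "x \<in> {0..1}"
  shows "C 0 x = 0" "C x 0 = 0" "C 1 x = x" "C x 1 = x"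
  using assms unfolding is_copula_def by blast+

lemma is_copula_rectangle:
  assumes "is_copula C" "0 \<le> x1" "x1 \<le> x2" "x2 \<le> 1" "0 \<le> y1" "y1 \<le> y2" "y2 \<le> 1"
  shows "C x1 y1 + C x2 y2 - C x1 y2 - C x2 y1 \<ge> 0"
  using assms unfolding is_copula_def by blast

text \<open>For the first variable, the rectangle over \<open>[a, b]\<close> with sides at heights 0
  and \<open>x\<close> gives monotonicity, and the one with heights \<open>x\<close> and 1 gives
  nonexpansiveness; the second variable is symmetric.\<close>

lemma is_copula_incr_nonexpansive:
  assumes C: "is_copula C" and x: "x \<in> {0..1}"
  shows "incr_nonexpansive (\<lambda>s. C s x)" "incr_nonexpansive (C x)"
proof -
  show "incr_nonexpansive (\<lambda>s. C s x)"
    unfolding incr_nonexpansive_def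
  proof (intro allI impI)
    fix a b :: real assume ab: "0 \<le> a" "a \<le> b" "b \<le> 1"
    show "C a x \<le> C b x \<and> C b x - C a x \<le> b - a"
      using is_copula_rectangle[OF C, of a b 0 x] is_copula_rectangle[OF C, of a b x 1]
        is_copula_boundary[OF C, of a] is_copula_boundary[OF C, of b] ab x by auto
  qed
  show "incr_nonexpansive (C x)"
    unfolding incr_nonexpansive_def
  proof (intro allI impI)
    fix a b :: real assume ab: "0 \<le> a" "a \<le> b" "b \<le> 1"
    show "C x a \<le> C x b \<and> C x b - C x a \<le> b - a"
      using is_copula_rectangle[OF C, of 0 x a b] is_copula_rectangle[OF C, of x 1 a b]
        is_copula_boundary[OF C, of a] is_copula_boundary[OF C, of b] ab x by auto
  qed
qed

text \<open>Monotonicity is the rectangle inequality itself; for the upper bound the increment of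
  the subtracted section is dropped.\<close>

lemma is_copula_diff_incr_nonexpansive:
  assumes C: "is_copula C" and y: "0 \<le> y1" "y1 \<le> y2" "y2 \<le> 1"
  shows "incr_nonexpansive (\<lambda>s. C s y2 - C s y1)"
  unfolding incr_nonexpansive_def
proof (intro allI impI)
  fix a b :: real assume ab: "0 \<le> a" "a \<le> b" "b \<le> 1"
  have "C a y1 \<le> C b y1"
    using incr_nonexpansiveD(1)[OF is_copula_incr_nonexpansive(1)[OF C, of y1] ab] y by simp
  moreover have "C b y2 - C a y2 \<le> b - a"
    using incr_nonexpansiveD(2)[OF is_copula_incr_nonexpansive(1)[OF C, of y2] ab] y by simp
  ultimately show "C a y2 - C a y1 \<le> C b y2 - C b y1 \<and> C b y2 - C b y1 - (C a y2 - C a y1) \<le> b - a"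
    using is_copula_rectangle[OF C ab y] by linarith
qed

text \<open>An increment in \<open>y\<close> is the pairing of \<open>f\<close> with a difference of
  sections, hence between 0 and the total increment of that difference, which is
  \<open>y2 - y1\<close> by the boundary conditions.\<close>

lemma deriv_pairing_copula_incr_nonexpansive:
  assumes C: "is_copula C" and f: "incr_nonexpansive f"
  shows "incr_nonexpansive (\<lambda>y. deriv_pairing f (\<lambda>s. C s y))"
  unfolding incr_nonexpansive_def
proof (intro allI impI)
  fix y1 y2 :: real assume y: "0 \<le> y1" "y1 \<le> y2" "y2 \<le> 1"
  let ?\<delta> = "\<lambda>s. C s y2 - C s y1"
  note \<delta> = is_copula_diff_incr_nonexpansive[OF C y]
  have "deriv_pairing f ?\<delta> = deriv_pairing f (\<lambda>s. C s y2) - deriv_pairing f (\<lambda>s. C s y1)"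
    using deriv_pairing_lincomb_right[OF is_copula_incr_nonexpansive(1)[OF C, of y2]
        is_copula_incr_nonexpansive(1)[OF C, of y1] f, of 1 "-1"] y by simp
  then show "deriv_pairing f (\<lambda>s. C s y1) \<le> deriv_pairing f (\<lambda>s. C s y2) \<and>
      deriv_pairing f (\<lambda>s. C s y2) - deriv_pairing f (\<lambda>s. C s y1) \<le> y2 - y1"
    using deriv_pairing_bounds[OF f \<delta>] y
      is_copula_boundary[OF C, of y1] is_copula_boundary[OF C, of y2] by simp
qed

lemma min_incr_nonexpansive: "incr_nonexpansive (min u)" "incr_nonexpansive (\<lambda>s. min s u)"
  by (auto simp: incr_nonexpansive_def min_def)

lemma is_copula_min: "is_copula min_copula"
  by (auto simp: is_copula_def min_copula_def min_def)

lemma is_copula_indep: "is_copula indep_copula"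
proof -
  have "0 \<le> (x2 - x1) * (y2 - y1)" if "x1 \<le> x2" "y1 \<le> y2" for x1 x2 y1 y2 :: real using that by simp
  then show ?thesis
    by (auto simp: is_copula_def indep_copula_def algebra_simps mult_le_one)
qed

lemma is_copula_convex_combination:
  assumes A: "is_copula A" and B: "is_copula B" and \<theta>: "\<theta> \<in> {0..1}"
  shows "is_copula (\<lambda>u v. A u v + \<theta> * (B u v - A u v))"
proof -
  have eq: "A u v + \<theta> * (B u v - A u v) = (1 - \<theta>) * A u v + \<theta> * B u v" for u v
    by (simp add: algebra_simps)
  show ?thesis
    unfolding is_copula_def eq
  proof (intro conjI ballI allI impI)
    fix x y :: real assume xy: "x \<in> {0..1}" "y \<in> {0..1}"
    have "A x y \<in> {0..1}" "B x y \<in> {0..1}" using A B xy unfolding is_copula_def by blast+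
    then have "0 \<le> (1 - \<theta>) * A x y + \<theta> * B x y" "(1 - \<theta>) * A x y + \<theta> * B x y \<le> 1"
      using \<theta> by (auto intro!: convex_bound_le)
    then show "(1 - \<theta>) * A x y + \<theta> * B x y \<in> {0..1}" by simp
  next
    fix x1 x2 y1 y2 :: real assume r: "0 \<le> x1" "x1 \<le> x2" "x2 \<le> 1" "0 \<le> y1" "y1 \<le> y2" "y2 \<le> 1"
    have "0 \<le> (1 - \<theta>) * (A x1 y1 + A x2 y2 - A x1 y2 - A x2 y1) + \<theta> * (B x1 y1 + B x2 y2 - B x1 y2 - B x2 y1)"
      using \<theta> is_copula_rectangle[OF A r] is_copula_rectangle[OF B r] by (intro add_nonneg_nonneg mult_nonneg_nonneg) auto
    then show "0 \<le> (1 - \<theta>) * A x1 y1 + \<theta> * B x1 y1 + ((1 - \<theta>) * A x2 y2 + \<theta> * B x2 y2) -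
        ((1 - \<theta>) * A x1 y2 + \<theta> * B x1 y2) - ((1 - \<theta>) * A x2 y1 + \<theta> * B x2 y1)"
      by (simp add: algebra_simps)
  qed (use is_copula_boundary[OF A] is_copula_boundary[OF B] in \<open>auto simp: algebra_simps\<close>)
qed

lemma is_copula_hat: "is_copula C \<Longrightarrow> \<theta> \<in> {0..1} \<Longrightarrow> is_copula (hat_copula \<theta> C)"
  unfolding hat_copula_def[abs_def] by (rule is_copula_convex_combination[OF _ is_copula_min])

lemma is_copula_tilde: "is_copula C \<Longrightarrow> \<theta> \<in> {0..1} \<Longrightarrow> is_copula (tilde_copula \<theta> C)"
  unfolding tilde_copula_def[abs_def] by (rule is_copula_convex_combination[OF _ is_copula_indep])

section \<open>Powers and their closed forms\<close>

text \<open>The convention that the zeroth power is \<open>M\<close> makes the recursion uniform;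
  its first step is the unit law.\<close>

lemma copula_power_Suc:
  assumes C: "is_copula C" and uv: "u \<in> {0..1}" "v \<in> {0..1}"
  shows "copula_power C (Suc n) u v = deriv_pairing (copula_power C n u) (\<lambda>s. C s v)"
proof (cases n)
  case 0
  have "deriv_pairing (\<lambda>s. C s v) (\<lambda>s. min s u) = C u v - C 0 v"
    using uv by (intro deriv_pairing_min is_copula_incr_nonexpansive(1)[OF C]) auto
  moreover have "min_copula u = (\<lambda>s. min s u)" by (auto simp: min_copula_def min.commute)
  ultimately show ?thesis
    using 0 is_copula_boundary(1)[OF C uv(2)] by (simp add: deriv_pairing_commute)
next
  case (Suc m)
  then show ?thesis by (simp add: fold_product_eq_deriv_pairing)
qed

text \<open>The section at \<open>u\<close> behaves like the distribution function of a measure of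
  mass \<open>u\<close> on the unit interval; later it is the law of \<open>X n\<close> on the event
  \<open>X 0 \<le> u\<close>.\<close>

lemma copula_power_section:
  assumes C: "is_copula C" and u: "u \<in> {0..1}"
  shows "incr_nonexpansive (copula_power C n u)" "copula_power C n u 0 = 0" "copula_power C n u 1 = u"
proof (induction n)
  case 0
  { case 1 show ?case using min_incr_nonexpansive(1) by (simp add: min_copula_def[abs_def]) }
  { case 2 show ?case using u by (simp add: min_copula_def) }
  { case 3 show ?case using u by (simp add: min_copula_def) }
next
  case (Suc n)
  note f = Suc.IH(1)
  { case 1
    show ?case
      using deriv_pairing_copula_incr_nonexpansive[OF C f] copula_power_Suc[OF C u, of _ n]
      unfolding incr_nonexpansive_def by auto }
  { case 2
    \<comment> \<open>The boundary sections of \<open>C\<close> are linear, \<open>s * 0\<close>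
      here and \<open>s * 1\<close> below, so both end values come from pairing with a linear
      function.\<close>
    have "deriv_pairing (copula_power C n u) (\<lambda>s. C s 0) = deriv_pairing (copula_power C n u) (\<lambda>s. s * 0)"
      unfolding deriv_pairing_commute[of "copula_power C n u"]
      by (rule deriv_pairing_cong) (use is_copula_boundary[OF C] in auto)
    then show ?case using copula_power_Suc[OF C u, of 0 n] deriv_pairing_mult_right[OF f, of 0] by simp }
  { case 3
    have "deriv_pairing (copula_power C n u) (\<lambda>s. C s 1) = deriv_pairing (copula_power C n u) (\<lambda>s. s * 1)"
      unfolding deriv_pairing_commute[of "copula_power C n u"]
      by (rule deriv_pairing_cong) (use is_copula_boundary[OF C] in auto)
    then show ?case
      using copula_power_Suc[OF C u, of 1 n] deriv_pairing_mult_right[OF f, of 1] Suc.IH(2,3) by simp }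
qed

text \<open>With \<open>S\<close> the shift of sequences, this is the expansion of
  \<open>(a + b S)^(n+1)\<close> as \<open>(a + b S)^n\<close> applied to
  \<open>(a + b S) f\<close>. Pascal's rule is the whole content.\<close>

lemma binomial_sum_Suc:
  fixes f :: "nat \<Rightarrow> real"
  shows "(\<Sum>i\<le>Suc n. real (Suc n choose i) * a ^ (Suc n - i) * b ^ i * f i) =
    (\<Sum>i\<le>n. real (n choose i) * a ^ (n - i) * b ^ i * (b * f (Suc i) + a * f i))"
proof -
  let ?g = "\<lambda>i. real (n choose i) * a ^ (n - i) * b ^ i"
  have "(\<Sum>i\<le>Suc n. real (Suc n choose i) * a ^ (Suc n - i) * b ^ i * f i) =
    a ^ Suc n * f 0 + (\<Sum>i\<le>n. real (Suc n choose Suc i) * a ^ (n - i) * b ^ Suc i * f (Suc i))"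
    by (subst sum.atMost_Suc_shift) simp
  also have "(\<Sum>i\<le>n. real (Suc n choose Suc i) * a ^ (n - i) * b ^ Suc i * f (Suc i)) =
    (\<Sum>i\<le>n. ?g i * (b * f (Suc i))) + (\<Sum>i\<le>n. real (n choose Suc i) * a ^ (n - i) * b ^ Suc i * f (Suc i))"
    by (simp add: sum.distrib[symmetric] algebra_simps)
  also have "a ^ Suc n * f 0 + \<dots> = (\<Sum>i\<le>n. ?g i * (b * f (Suc i))) +
      (a ^ Suc n * f 0 + (\<Sum>i\<le>n. real (n choose Suc i) * a ^ (n - i) * b ^ Suc i * f (Suc i)))"
    by simp
  also have "a ^ Suc n * f 0 + (\<Sum>i\<le>n. real (n choose Suc i) * a ^ (n - i) * b ^ Suc i * f (Suc i)) =
      (\<Sum>i\<le>Suc n. real (n choose i) * a ^ (Suc n - i) * b ^ i * f i)"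
    by (subst sum.atMost_Suc_shift) simp
  \<comment> \<open>The top summand vanishes since \<open>n choose Suc n\<close> is 0.\<close>
  also have "\<dots> = (\<Sum>i\<le>n. real (n choose i) * a ^ (Suc n - i) * b ^ i * f i)"
    by (simp add: binomial_eq_0)
  also have "\<dots> = (\<Sum>i\<le>n. ?g i * (a * f i))"
    by (rule sum.cong) (auto simp: Suc_diff_le)
  finally show ?thesis by (simp add: sum.distrib[symmetric] algebra_simps)
qed

text \<open>With \<open>C\<^sup>0 = M\<close> the term \<open>\<theta>\<^sup>n M\<close> is the summand \<open>i = 0\<close>.\<close>

lemma copula_power_hat:
  assumes C: "is_copula C" and \<theta>: "\<theta> \<in> {0..1}" and u: "u \<in> {0..1}"
  shows "v \<in> {0..1} \<Longrightarrow> copula_power (hat_copula \<theta> C) n u v =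
    (\<Sum>i\<le>n. real (n choose i) * \<theta> ^ (n - i) * (1 - \<theta>) ^ i * copula_power C i u v)"
proof (induction n arbitrary: v)
  case (Suc n)
  let ?c = "\<lambda>i. real (n choose i) * \<theta> ^ (n - i) * (1 - \<theta>) ^ i"
  have v: "v \<in> {0..1}" by fact
  note H = is_copula_hat[OF C \<theta>]
  note P = copula_power_section[OF C u] and S = is_copula_incr_nonexpansive(1)[OF H v]
  \<comment> \<open>The \<open>C\<close> part of the generator raises the power by one, and its
    \<open>M\<close> part leaves the power unchanged.\<close>
  have step: "deriv_pairing (copula_power C i u) (\<lambda>s. hat_copula \<theta> C s v) =
      (1 - \<theta>) * copula_power C (Suc i) u v + \<theta> * copula_power C i u v" for i
  proof -
    have "(\<lambda>s. hat_copula \<theta> C s v) = (\<lambda>s. (1 - \<theta>) * C s v + \<theta> * min s v)"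
      by (auto simp: hat_copula_def min_copula_def algebra_simps)
    then have "deriv_pairing (copula_power C i u) (\<lambda>s. hat_copula \<theta> C s v) =
        (1 - \<theta>) * deriv_pairing (copula_power C i u) (\<lambda>s. C s v) +
        \<theta> * deriv_pairing (copula_power C i u) (\<lambda>s. min s v)"
      using deriv_pairing_lincomb_right[OF is_copula_incr_nonexpansive(1)[OF C v] min_incr_nonexpansive(2) P(1)]
      by simp
    then show ?thesis
      using copula_power_Suc[OF C u v] deriv_pairing_min[OF P(1)] P(2) v by simp
  qed
  have "copula_power (hat_copula \<theta> C) (Suc n) u v =
      deriv_pairing (copula_power (hat_copula \<theta> C) n u) (\<lambda>s. hat_copula \<theta> C s v)"
    by (rule copula_power_Suc[OF H u v])
  also have "\<dots> = deriv_pairing (\<lambda>t. \<Sum>i\<le>n. ?c i * copula_power C i u t) (\<lambda>s. hat_copula \<theta> C s v)"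
    by (rule deriv_pairing_cong) (simp add: Suc.IH)
  also have "\<dots> = (\<Sum>i\<le>n. ?c i * deriv_pairing (copula_power C i u) (\<lambda>s. hat_copula \<theta> C s v))"
    by (rule deriv_pairing_sum_left[OF P(1) S]) simp
  also have "\<dots> = (\<Sum>i\<le>Suc n. real (Suc n choose i) * \<theta> ^ (Suc n - i) * (1 - \<theta>) ^ i * copula_power C i u v)"
    unfolding step by (rule binomial_sum_Suc[symmetric])
  finally show ?case .
qed simp

text \<open>\<open>\<Pi>\<close> absorbs multiplication by a copula from either side. So each step
  moves the fraction \<open>\<theta>\<close> of the weight still on the power of \<open>C\<close>
  over to \<open>\<Pi>\<close>, and weight on \<open>\<Pi>\<close> stays there.\<close>

lemma copula_power_tilde:
  assumes C: "is_copula C" and \<theta>: "\<theta> \<in> {0..1}" and u: "u \<in> {0..1}"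
  shows "v \<in> {0..1} \<Longrightarrow> copula_power (tilde_copula \<theta> C) (Suc n) u v =
    (1 - \<theta>) ^ Suc n * copula_power C (Suc n) u v + (1 - (1 - \<theta>) ^ Suc n) * indep_copula u v"
proof (induction n arbitrary: v)
  case 0
  show ?case by (simp add: tilde_copula_def algebra_simps)
next
  case (Suc n)
  have v: "v \<in> {0..1}" by fact
  let ?q = "(1 - \<theta>) ^ Suc n"
  note T = is_copula_tilde[OF C \<theta>]
  note P = copula_power_section[OF C u, of "Suc n"] and I = is_copula_incr_nonexpansive[OF is_copula_indep u]
  have eq: "(\<lambda>s. tilde_copula \<theta> C s v) = (\<lambda>s. (1 - \<theta>) * C s v + \<theta> * (s * v))"
    by (auto simp: tilde_copula_def indep_copula_def algebra_simps)
  have Iv: "incr_nonexpansive (\<lambda>s. s * v)"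
    using is_copula_incr_nonexpansive(1)[OF is_copula_indep v] by (simp add: indep_copula_def)
  \<comment> \<open>For both sections paired below the increment \<open>f 1 - f 0\<close> is
    \<open>u\<close>, so the \<open>\<Pi>\<close> part contributes \<open>\<theta> * (u * v)\<close>
    in each case.\<close>
  have pair: "deriv_pairing f (\<lambda>s. tilde_copula \<theta> C s v) =
      (1 - \<theta>) * deriv_pairing f (\<lambda>s. C s v) + \<theta> * (v * (f 1 - f 0))" if f: "incr_nonexpansive f" for f
    using deriv_pairing_lincomb_right[OF is_copula_incr_nonexpansive(1)[OF C v] Iv f]
      deriv_pairing_mult_right[OF f] unfolding eq by simp
  have "indep_copula u = (\<lambda>s. s * u)" by (auto simp: indep_copula_def)
  then have "deriv_pairing (indep_copula u) (\<lambda>s. C s v) = deriv_pairing (\<lambda>s. C s v) (\<lambda>s. s * u)"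
    by (simp only: deriv_pairing_commute)
  also have "\<dots> = u * v"
    using deriv_pairing_mult_right[OF is_copula_incr_nonexpansive(1)[OF C v]] is_copula_boundary[OF C v] by simp
  finally have IC: "deriv_pairing (indep_copula u) (\<lambda>s. C s v) = u * v" .
  have "copula_power (tilde_copula \<theta> C) (Suc (Suc n)) u v =
      deriv_pairing (copula_power (tilde_copula \<theta> C) (Suc n) u) (\<lambda>s. tilde_copula \<theta> C s v)"
    by (rule copula_power_Suc[OF T u v])
  also have "\<dots> = deriv_pairing (\<lambda>t. ?q * copula_power C (Suc n) u t + (1 - ?q) * indep_copula u t)
      (\<lambda>s. tilde_copula \<theta> C s v)"
    by (rule deriv_pairing_cong) (simp add: Suc.IH del: copula_power.simps power_Suc)
  also have "\<dots> = ?q * deriv_pairing (copula_power C (Suc n) u) (\<lambda>s. tilde_copula \<theta> C s v) +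
      (1 - ?q) * deriv_pairing (indep_copula u) (\<lambda>s. tilde_copula \<theta> C s v)"
    by (rule deriv_pairing_lincomb_left[OF P(1) I(2) is_copula_incr_nonexpansive(1)[OF T v]])
  also have "deriv_pairing (copula_power C (Suc n) u) (\<lambda>s. tilde_copula \<theta> C s v) =
      (1 - \<theta>) * copula_power C (Suc (Suc n)) u v + \<theta> * (u * v)"
    unfolding pair[OF P(1)] P(2,3) copula_power_Suc[OF C u v, of "Suc n"] by (simp add: mult.commute)
  also have "deriv_pairing (indep_copula u) (\<lambda>s. tilde_copula \<theta> C s v) = u * v"
    unfolding pair[OF I(2)] IC by (simp add: indep_copula_def algebra_simps)
  finally show ?case
    by (simp add: indep_copula_def algebra_simps del: copula_power.simps)
qed

section \<open>Markov chains\<close>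

text \<open>The unnormalised law of \<open>Y\<close> on \<open>A\<close> has the clamped
  \<open>f\<close> as distribution function, as does the measure with density
  \<open>deriv f\<close>; hence they coincide. It is used with \<open>A\<close> the whole space,
  \<open>A\<close> an event on the next state, and \<open>A\<close> an event on the initial
  state.\<close>

lemma (in prob_space) expectation_on_event_eq_integral_deriv:
  assumes A: "A \<in> events" and Y: "random_variable borel Y" and Y1: "AE \<omega> in M. Y \<omega> \<le> 1"
    and f: "incr_nonexpansive f" "f 0 = 0"
    and cdf: "\<And>t. 0 \<le> t \<Longrightarrow> t \<le> 1 \<Longrightarrow> prob {\<omega>\<in>A. Y \<omega> \<le> t} = f t"
    and \<phi>: "\<phi> \<in> borel_measurable borel"
  shows "expectation (\<lambda>\<omega>. indicator A \<omega> * \<phi> (Y \<omega>)) =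
    (\<integral>t. (indicator {0<..<1} t * deriv f t) * \<phi> t \<partial>lborel)"
proof -
  note [measurable] = A Y \<phi>
  let ?h = "\<lambda>t. indicator {0<..<1} t * deriv f t"
  define \<nu> where "\<nu> = distr (density M (indicator A)) borel Y"
  define \<mu> where "\<mu> = density lborel (\<lambda>t. ennreal (?h t))"
  have [measurable]: "?h \<in> borel_measurable borel"
    using borel_measurable_integrable[OF incr_nonexpansive_deriv(2)[OF f(1)]] by simp
  have h0: "AE t in lborel. 0 \<le> ?h t"
    using incr_nonexpansive_deriv(1)[OF f(1)] by eventually_elim (auto split: split_indicator)
  have e\<nu>: "emeasure \<nu> S = emeasure M (A \<inter> (Y -` S \<inter> space M))" if [measurable]: "S \<in> sets borel" for S
    unfolding \<nu>_def by (subst emeasure_distr) (simp_all add: emeasure_density nn_integral_indicator flip: indicator_inter_arith)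
  have \<nu>t: "measure \<nu> {..t} = f (max 0 (min 1 t))" for t
  proof -
    have m: "measure \<nu> {..t} = prob {\<omega>\<in>A. Y \<omega> \<le> t}" for t
    proof -
      have "A \<inter> (Y -` {..t} \<inter> space M) = {\<omega>\<in>A. Y \<omega> \<le> t}" using sets.sets_into_space[OF A] by auto
      then show ?thesis by (simp add: measure_def e\<nu>)
    qed
    have ev: "{\<omega>\<in>A. Y \<omega> \<le> t} \<in> events" for t
    proof -
      have "{\<omega>\<in>A. Y \<omega> \<le> t} = A \<inter> (Y -` {..t} \<inter> space M)" using sets.sets_into_space[OF A] by auto
      also have "\<dots> \<in> events" by measurable
      finally show ?thesis .
    qed
    \<comment> \<open>\<open>cdf\<close> speaks of \<open>{0..1}\<close> only: there is no mass
      below 0 as \<open>f 0 = 0\<close>, and none above 1 by \<open>Y1\<close>.\<close>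
    consider "t < 0" | "0 \<le> t" "t \<le> 1" | "1 < t" by linarith
    then show ?thesis
    proof cases
      case 1
      have "prob {\<omega>\<in>A. Y \<omega> \<le> t} \<le> prob {\<omega>\<in>A. Y \<omega> \<le> 0}"
        by (rule finite_measure_mono) (use 1 ev in auto)
      then have "prob {\<omega>\<in>A. Y \<omega> \<le> t} = 0" using cdf[of 0] f(2) by (simp add: measure_le_0_iff)
      then show ?thesis using 1 f(2) by (simp add: m)
    next
      case 2
      then show ?thesis by (simp add: m cdf)
    next
      case 3
      have "prob {\<omega>\<in>A. Y \<omega> \<le> t} = prob {\<omega>\<in>A. Y \<omega> \<le> 1}"
        by (rule finite_measure_eq_AE) (use Y1 3 ev in auto)
      then show ?thesis using 3 by (simp add: m cdf)
    qed
  qed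
  have \<mu>t: "emeasure \<mu> {..t} = ennreal (f (max 0 (min 1 t)))" for t
  proof -
    let ?b = "max 0 (min 1 t)"
    have ind: "indicator {..t} s * ?h s = indicator {..?b} s * ?h s" for s
      by (auto split: split_indicator)
    have "emeasure \<mu> {..t} = (\<integral>\<^sup>+s. ennreal (?h s) * indicator {..t} s \<partial>lborel)"
      unfolding \<mu>_def by (rule emeasure_density) auto
    also have "\<dots> = (\<integral>\<^sup>+s. ennreal (indicator {..?b} s * ?h s) \<partial>lborel)"
      unfolding ind[symmetric] by (rule nn_integral_cong) (auto split: split_indicator)
    also have "\<dots> = ennreal (\<integral>s. indicator {..?b} s * ?h s \<partial>lborel)"
    proof (rule nn_integral_eq_integral)
      show "integrable lborel (\<lambda>s. indicator {..?b} s * ?h s)"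
        using integrable_mult_indicator[OF _ incr_nonexpansive_deriv(2)[OF f(1)], of "{..?b}"] by simp
      show "AE s in lborel. 0 \<le> indicator {..?b} s * ?h s"
        using h0 by eventually_elim (simp split: split_indicator)
    qed
    also have "\<dots> = ennreal (f ?b)"
      using incr_nonexpansive_deriv(3)[OF f(1), of ?b] f(2) by simp
    finally show ?thesis .
  qed
  have \<mu>m: "measure \<mu> {..t} = f (max 0 (min 1 t))" for t
    using incr_nonexpansiveD(1)[OF f(1), of 0 "max 0 (min 1 t)"] f(2) by (simp add: measure_def \<mu>t)
  have "\<nu> = \<mu>"
  proof (rule cdf_unique')
    have "emeasure \<nu> (space \<nu>) \<le> emeasure M (space M)"
      using e\<nu>[of UNIV] emeasure_space[of M A] by (simp add: \<nu>_def)
    then show "finite_borel_measure \<nu>"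
      by (intro finite_borel_measure.intro finite_borel_measure_axioms.intro finite_measureI)
         (auto simp: \<nu>_def emeasure_space_1 top_unique)
    have "emeasure \<mu> (space \<mu>) = (\<integral>\<^sup>+s. ennreal (?h s) \<partial>lborel)"
      by (simp add: \<mu>_def emeasure_density)
    also have "\<dots> = ennreal (\<integral>s. ?h s \<partial>lborel)"
      by (rule nn_integral_eq_integral[OF incr_nonexpansive_deriv(2)[OF f(1)] h0])
    finally show "finite_borel_measure \<mu>"
      by (intro finite_borel_measure.intro finite_borel_measure_axioms.intro finite_measureI)
         (auto simp: \<mu>_def)
    show "cdf \<nu> = cdf \<mu>" by (auto simp: cdf_def \<nu>t \<mu>m)
  qed
  have "expectation (\<lambda>\<omega>. indicator A \<omega> * \<phi> (Y \<omega>)) = integral\<^sup>L (density M (\<lambda>\<omega>. ennreal (indicator A \<omega>))) (\<lambda>\<omega>. \<phi> (Y \<omega>))"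
    by (subst integral_density) auto
  also have "\<dots> = integral\<^sup>L \<nu> \<phi>"
    unfolding \<nu>_def by (subst integral_distr) (auto simp: ennreal_indicator)
  also have "\<dots> = (\<integral>t. ?h t * \<phi> t \<partial>lborel)"
    unfolding \<open>\<nu> = \<mu>\<close> \<mu>_def by (subst integral_density[OF _ _ h0]) auto
  finally show ?thesis .
qed

lemma uniform_unit_cdf:
  assumes "t \<in> {0..1}"
  shows "measure (uniform_measure lborel {0<..<1}) {..t} = t"
proof -
  have "{0<..<1} \<inter> {..t} = (if t < 1 then {0<..t} else {0<..<1})" using assms by auto
  then show ?thesis using assms by simp
qed

lemma subalgebra_vimage_algebra:
  assumes "f \<in> measurable M N"
  shows "subalgebra M (vimage_algebra (space M) f N)"
  unfolding subalgebra_def using sets_image_in_sets[OF refl assms] by simp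

lemma (in prob_space) sigma_finite_subalgebra_vimage_algebra:
  assumes "f \<in> measurable M N"
  shows "sigma_finite_subalgebra M (vimage_algebra (space M) f N)"
proof -
  interpret finite_measure_subalgebra M "vimage_algebra (space M) f N"
    by unfold_locales (rule subalgebra_vimage_algebra[OF assms])
  show ?thesis by unfold_locales
qed

section \<open>Uniform chains generated by a copula\<close>

locale uniform_chain = prob_space M for M :: "'a measure" +
  fixes X :: "nat \<Rightarrow> 'a \<Rightarrow> real" and n :: nat and D :: "real \<Rightarrow> real \<Rightarrow> real"
  assumes chain: "markov_chain M X n" and unif: "uniform_marginals M X n"
    and copula: "is_copula D" and gen: "generated_by M X n D"
begin

lemma rv: "i \<le> n \<Longrightarrow> random_variable borel (X i)"
  using chain by (simp add: markov_chain_def)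

lemma prob_le: "i \<le> n \<Longrightarrow> t \<in> {0..1} \<Longrightarrow> prob {\<omega>\<in>space M. X i \<omega> \<le> t} = t"
proof -
  assume i: "i \<le> n" and t: "t \<in> {0..1}"
  have "prob {\<omega>\<in>space M. X i \<omega> \<le> t} = measure (distr M borel (X i)) {..t}"
    using rv[OF i] by (simp add: measure_distr vimage_def Int_def conj_commute)
  also have "\<dots> = t"
    using unif i uniform_unit_cdf[OF t] by (simp add: uniform_marginals_def)
  finally show ?thesis .
qed

lemma AE_le_1: "i \<le> n \<Longrightarrow> AE \<omega> in M. X i \<omega> \<le> 1"
  using prob_le[of i 1] rv[of i] by (subst prob_Collect_eq_1[symmetric]) auto

text \<open>Over an event \<open>X i \<in> S\<close> both sides integrate to the Lebesgue integral
  of \<open>deriv (\<lambda>s. D s v)\<close> over \<open>S\<close> within the unit interval: one by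
  the joint distribution \<open>D\<close>, the other by the uniform law of \<open>X i\<close>. The
  indicator makes the version Borel on the line, and \<open>X i\<close> lies in the open interval
  almost surely.\<close>

lemma transition_probability:
  assumes i: "i < n" and v: "v \<in> {0..1}"
  shows "AE \<omega> in M. real_cond_exp M (vimage_algebra (space M) (X i) borel)
      (\<lambda>\<omega>. indicator {..v} (X (Suc i) \<omega>)) \<omega> =
    indicator {0<..<1} (X i \<omega>) * deriv (\<lambda>s. D s v) (X i \<omega>)"
proof -
  let ?d = "\<lambda>t. indicator {0<..<1} t * deriv (\<lambda>s. D s v) t :: real"
  let ?G = "vimage_algebra (space M) (X i) borel"
  have rvs[measurable]: "random_variable borel (X i)" "random_variable borel (X (Suc i))"
    using i by (auto intro: rv)
  interpret sigma_finite_subalgebra M ?G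
    by (rule sigma_finite_subalgebra_vimage_algebra[OF rvs(1)])
  note f = is_copula_incr_nonexpansive(1)[OF copula v]
  have dm[measurable]: "?d \<in> borel_measurable borel"
    using borel_measurable_integrable[OF incr_nonexpansive_deriv(2)[OF f]] by simp
  let ?A = "{\<omega>\<in>space M. X (Suc i) \<omega> \<le> v}"
  have uni: "expectation (\<lambda>\<omega>. indicator (space M) \<omega> * \<phi> (X i \<omega>)) =
      (\<integral>t. indicator {0<..<1} t * \<phi> t \<partial>lborel)" if \<phi>: "\<phi> \<in> borel_measurable borel"
    for \<phi> :: "real \<Rightarrow> real"
  proof -
    \<comment> \<open>The uniform law is the case of the identity, whose derivative is 1.\<close>
    have "incr_nonexpansive (\<lambda>t. t)" by (simp add: incr_nonexpansive_def)
    then have "expectation (\<lambda>\<omega>. indicator (space M) \<omega> * \<phi> (X i \<omega>)) =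
      (\<integral>t. (indicator {0<..<1} t * deriv (\<lambda>t. t) t) * \<phi> t \<partial>lborel)"
      using i \<phi> prob_le[of i] AE_le_1[of i]
      by (intro expectation_on_event_eq_integral_deriv) auto
    then show ?thesis by simp
  qed
  show ?thesis
  proof (rule real_cond_exp_charact)
    \<comment> \<open>The bound may fail where the derivative does not exist; the uniform law of
      \<open>X i\<close> turns this null set into a null event.\<close>
    have bdd: "AE t in lborel. t \<in> {0<..<1} \<longrightarrow> norm (?d t) \<le> 1"
      using incr_nonexpansive_deriv(1)[OF f] by eventually_elim (auto split: split_indicator)
    have "AE t in uniform_measure lborel {0<..<1}. norm (?d t) \<le> 1"
      by (rule AE_uniform_measureI) (use bdd in simp_all)
    moreover have "distr M borel (X i) = uniform_measure lborel {0<..<1}"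
      using unif i by (simp add: uniform_marginals_def)
    ultimately have "AE t in distr M borel (X i). norm (?d t) \<le> 1" by (simp only:)
    then have "AE \<omega> in M. norm (?d (X i \<omega>)) \<le> 1"
      by (subst (asm) AE_distr_iff) auto
    then show "integrable M (\<lambda>\<omega>. ?d (X i \<omega>))"
      by (rule integrable_const_bound) measurable
    show "integrable M (\<lambda>\<omega>. indicator {..v} (X (Suc i) \<omega>) :: real)"
      by (rule integrable_const_bound[where B = 1]) auto
    have "X i \<in> measurable ?G borel" by (rule measurable_vimage_algebra1) auto
    then show "(\<lambda>\<omega>. ?d (X i \<omega>)) \<in> borel_measurable ?G"
      by (rule measurable_compose) (rule dm)
  next
    fix B assume "B \<in> sets ?G"
    then obtain S where S[measurable]: "S \<in> sets borel" and B: "B = X i -` S \<inter> space M"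
      by (subst (asm) sets_vimage_algebra2) auto
    have "(\<integral>\<omega>\<in>B. indicator {..v} (X (Suc i) \<omega>) \<partial>M) =
        expectation (\<lambda>\<omega>. indicator ?A \<omega> * indicator S (X i \<omega>) :: real)"
      unfolding set_lebesgue_integral_def
      by (rule Bochner_Integration.integral_cong) (auto simp: B split: split_indicator)
    also have "\<dots> = (\<integral>t. ?d t * indicator S t \<partial>lborel)"
    proof (rule expectation_on_event_eq_integral_deriv)
      show "D 0 v = 0" by (rule is_copula_boundary[OF copula v])
      fix t :: real assume t: "0 \<le> t" "t \<le> 1"
      have "{\<omega> \<in> ?A. X i \<omega> \<le> t} = {\<omega> \<in> space M. X i \<omega> \<le> t \<and> X (Suc i) \<omega> \<le> v}" by auto
      then show "prob {\<omega> \<in> ?A. X i \<omega> \<le> t} = D t v"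
        using gen i t v by (simp add: generated_by_def joint_cdf_def)
    qed (use f AE_le_1[of i] i in auto)
    also have "\<dots> = (\<integral>t. indicator {0<..<1} t * (?d t * indicator S t) \<partial>lborel)"
      by (rule Bochner_Integration.integral_cong) (auto split: split_indicator)
    also have "\<dots> = expectation (\<lambda>\<omega>. indicator (space M) \<omega> * (?d (X i \<omega>) * indicator S (X i \<omega>)))"
      by (rule uni[symmetric]) measurable
    also have "\<dots> = (\<integral>\<omega>\<in>B. ?d (X i \<omega>) \<partial>M)"
      unfolding set_lebesgue_integral_def
      by (rule Bochner_Integration.integral_cong) (auto simp: B split: split_indicator)
    finally show "(\<integral>\<omega>\<in>B. indicator {..v} (X (Suc i) \<omega>) \<partial>M) = (\<integral>\<omega>\<in>B. ?d (X i \<omega>) \<partial>M)" .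
  qed
qed

text \<open>\<open>v\<close> is generalised because the step uses the whole distribution function of
  \<open>X i\<close> on the event \<open>X 0 \<le> u\<close>, not a single value.\<close>

lemma joint_cdf_eq_copula_power:
  assumes u: "u \<in> {0..1}"
  shows "i \<le> n \<Longrightarrow> v \<in> {0..1} \<Longrightarrow> joint_cdf M (X 0) (X i) u v = copula_power D i u v"
proof (induction i arbitrary: v)
  case 0
  \<comment> \<open>The copula of \<open>(X 0, X 0)\<close> is \<open>M\<close>, which matches the
    zeroth power.\<close>
  have "{\<omega> \<in> space M. X 0 \<omega> \<le> u \<and> X 0 \<omega> \<le> v} = {\<omega> \<in> space M. X 0 \<omega> \<le> min u v}" by auto
  moreover have "min u v \<in> {0..1}" using u 0 by auto
  ultimately show ?case using prob_le[of 0 "min u v"] by (simp add: joint_cdf_def min_copula_def)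
next
  case (Suc i)
  have v: "v \<in> {0..1}" and i: "i < n" using Suc.prems by auto
  let ?d = "\<lambda>t. indicator {0<..<1} t * deriv (\<lambda>s. D s v) t :: real"
  let ?Y = "\<lambda>\<omega>. \<lambda>j\<in>{..i}. X j \<omega>"
  let ?N = "\<Pi>\<^sub>M j\<in>{..i}. (borel :: real measure)"
  let ?F = "vimage_algebra (space M) ?Y ?N"
  let ?A = "{\<omega>\<in>space M. X 0 \<omega> \<le> u}"
  let ?g = "\<lambda>\<omega>. indicator {..v} (X (Suc i) \<omega>) :: real"
  have [measurable]: "random_variable borel (X 0)" "random_variable borel (X i)" "random_variable borel (X (Suc i))"
    using i by (auto intro: rv)
  have Y: "?Y \<in> measurable M ?N"
    using i by (intro measurable_restrict rv) auto
  interpret sigma_finite_subalgebra M ?F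
    by (rule sigma_finite_subalgebra_vimage_algebra[OF Y])
  have "?Y \<in> measurable ?F ?N"
    using measurable_space[OF Y] by (intro measurable_vimage_algebra1) auto
  then have "(\<lambda>\<omega>. ?Y \<omega> 0) \<in> borel_measurable ?F"
    by (rule measurable_compose) (rule measurable_component_singleton, simp)
  then have X0: "X 0 \<in> borel_measurable ?F" by simp
  have "(\<lambda>\<omega>. indicator {..u} (X 0 \<omega>) :: real) \<in> borel_measurable ?F"
    by (rule measurable_compose[OF X0]) simp
  moreover have "integrable M (\<lambda>\<omega>. indicator {..u} (X 0 \<omega>) * ?g \<omega>)"
    by (rule integrable_const_bound[where B = 1]) (auto split: split_indicator)
  \<comment> \<open>The event \<open>X 0 \<le> u\<close> belongs to the history, but in general not
    to the sigma-algebra of \<open>X i\<close>. So the conditional expectation is inserted given the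
    history and only then replaced, by the Markov property, with the one given
    \<open>X i\<close>.\<close>
  ultimately have tower: "expectation (\<lambda>\<omega>. indicator {..u} (X 0 \<omega>) * real_cond_exp M ?F ?g \<omega>) =
      expectation (\<lambda>\<omega>. indicator {..u} (X 0 \<omega>) * ?g \<omega>)"
    by (intro real_cond_exp_intg(2)) auto
  have "AE \<omega> in M. real_cond_exp M ?F ?g \<omega> = real_cond_exp M (vimage_algebra (space M) (X i) borel) ?g \<omega>"
    using chain i by (auto simp: markov_chain_def)
  then have trans: "AE \<omega> in M. real_cond_exp M ?F ?g \<omega> = ?d (X i \<omega>)"
    using transition_probability[OF i v] by eventually_elim simp
  note f = copula_power_section[OF copula u, of i] and g = is_copula_incr_nonexpansive(1)[OF copula v]
  have [measurable]: "?d \<in> borel_measurable borel"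
    using borel_measurable_integrable[OF incr_nonexpansive_deriv(2)[OF g]] by simp
  have "joint_cdf M (X 0) (X (Suc i)) u v = expectation (indicator {\<omega>\<in>space M. X 0 \<omega> \<le> u \<and> X (Suc i) \<omega> \<le> v})"
    unfolding joint_cdf_def by (subst Bochner_Integration.integral_indicator) auto
  also have "\<dots> = expectation (\<lambda>\<omega>. indicator {..u} (X 0 \<omega>) * ?g \<omega>)"
    by (rule Bochner_Integration.integral_cong) (auto split: split_indicator)
  also have "\<dots> = expectation (\<lambda>\<omega>. indicator {..u} (X 0 \<omega>) * real_cond_exp M ?F ?g \<omega>)"
    by (rule tower[symmetric])
  also have "\<dots> = expectation (\<lambda>\<omega>. indicator ?A \<omega> * ?d (X i \<omega>))"
  proof (rule integral_cong_AE)
    show "(\<lambda>\<omega>. indicator {..u} (X 0 \<omega>) * real_cond_exp M ?F ?g \<omega>) \<in> borel_measurable M"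
      by measurable
    show "(\<lambda>\<omega>. indicator ?A \<omega> * ?d (X i \<omega>)) \<in> borel_measurable M"
      by measurable
    show "AE \<omega> in M. indicator {..u} (X 0 \<omega>) * real_cond_exp M ?F ?g \<omega> = indicator ?A \<omega> * ?d (X i \<omega>)"
      using trans AE_space by eventually_elim (simp split: split_indicator)
  qed
  also have "\<dots> = (\<integral>t. (indicator {0<..<1} t * deriv (copula_power D i u) t) * ?d t \<partial>lborel)"
  proof (rule expectation_on_event_eq_integral_deriv)
    fix t :: real assume t: "0 \<le> t" "t \<le> 1"
    have "{\<omega> \<in> ?A. X i \<omega> \<le> t} = {\<omega> \<in> space M. X 0 \<omega> \<le> u \<and> X i \<omega> \<le> t}" by auto
    then show "prob {\<omega> \<in> ?A. X i \<omega> \<le> t} = copula_power D i u t"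
      using Suc.IH[of t] i t by (simp add: joint_cdf_def)
  qed (use f AE_le_1[of i] i in auto)
  also have "\<dots> = copula_power D (Suc i) u v"
    unfolding copula_power_Suc[OF copula u v] deriv_pairing_eq ..
  finally show ?case .
qed

end

theorem proposition1p2p1:
  fixes C :: "real \<Rightarrow> real \<Rightarrow> real" and \<theta> :: real
    and M :: "'a measure" and X :: "nat \<Rightarrow> 'a \<Rightarrow> real" and n :: nat
  assumes "is_copula C"
    and "\<theta> \<in> {0..1}"
    and "n \<ge> 1"
    and "prob_space M"
    and "markov_chain M X n"
    and "stationary M X n"
    and "uniform_marginals M X n"
  shows
    "(generated_by M X n (hat_copula \<theta> C) \<longrightarrow>
       (\<forall>u\<in>{0..1}. \<forall>v\<in>{0..1}.
          joint_cdf M (X 0) (X n) u v = copula_power (hat_copula \<theta> C) n u v \<and>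
          copula_power (hat_copula \<theta> C) n u v =
            (\<Sum>i=1..n. real (n choose i) * \<theta> ^ (n - i) * (1 - \<theta>) ^ i * copula_power C i u v)
              + \<theta> ^ n * min_copula u v)) \<and>
     (generated_by M X n (tilde_copula \<theta> C) \<longrightarrow>
       (\<forall>u\<in>{0..1}. \<forall>v\<in>{0..1}.
          joint_cdf M (X 0) (X n) u v = copula_power (tilde_copula \<theta> C) n u v \<and>
          copula_power (tilde_copula \<theta> C) n u v =
            (1 - \<theta>) ^ n * copula_power C n u v + (1 - (1 - \<theta>) ^ n) * indep_copula u v))"
proof -
  have cdf: "joint_cdf M (X 0) (X n) u v = copula_power D n u v"
    if "is_copula D" "generated_by M X n D" "u \<in> {0..1}" "v \<in> {0..1}" for D u v
  proof -
    interpret uniform_chain M X n D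
      using assms that by (simp add: uniform_chain_def uniform_chain_axioms_def)
    show ?thesis using joint_cdf_eq_copula_power that by simp
  qed
  have hat: "copula_power (hat_copula \<theta> C) n u v =
      (\<Sum>i=1..n. real (n choose i) * \<theta> ^ (n - i) * (1 - \<theta>) ^ i * copula_power C i u v)
        + \<theta> ^ n * min_copula u v" if "u \<in> {0..1}" "v \<in> {0..1}" for u v
  proof -
    have "{..n} = insert 0 {1..n}" by auto
    then show ?thesis using copula_power_hat[OF assms(1,2) that, of n] by simp
  qed
  obtain m where m: "n = Suc m" using \<open>n \<ge> 1\<close> by (cases n) auto
  show ?thesis
    using cdf[OF is_copula_hat[OF assms(1,2)]] hat
      cdf[OF is_copula_tilde[OF assms(1,2)]] copula_power_tilde[OF assms(1,2), of _ _ m]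
    unfolding m by simp
qed

end
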